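(* Let $\rho>0$, let $C$ be a nonempty, closed, convex set in a Banach space $X$ and let $r\geq 0$. The following assertions are equivalent. (1) $\mathrm{lr}(C,\rho)\geq r$. (2) For every finite set $F\subseteq rB_X$ there is $z\in\rho B_{X^{**}}$ such that $z+F\subseteq \mathrm{w}^*\text{-}\mathrm{cl}(C)$. (3) There is $z_0\in\rho B_{X^{**}}$ such that $z_0+rB_{X^{**}}\subseteq \mathrm{w}^*\text{-}\mathrm{cl}(C)$. In particular, $\mathrm{lr}(C,\rho)=\mathrm{ir}(\mathrm{w}^*\text{-}\mathrm{cl}(C),\rho)$ and, in case $X$ is separable, $C$ is Haar positive if and only if $\mathrm{w}^*\text{-}\mathrm{cl}(C)$ has nonempty interior in the norm topology of $X^{**}$.
   Context: All Banach spaces are real. $B_X$ is the closed unit ball of $X$, $X^{**}$ is the second dual, and $X$ is identified with its canonical image in $X^{**}$. For $C\subseteq X$, $\mathrm{w}^*\text{-}\mathrm{cl}(C)$ is the closure of $C$ in $X^{**}$ with respect to the weak$^*$ topology. Let $\rho>0$ and let $C$ be a nonempty, closed, convex subset of a Banach space $Y$ (used with $Y=X$ or $Y=X^{**}$). - The $\rho$-inner radius $\mathrm{ir}(C,\rho)$ is the supremum of all $r\geq 0$ such that $C$ contains a closed ball of the form $x+rB_Y$, where $x\in\rho B_Y$. - The $\rho$-loose radius $\mathrm{lr}(C,\rho)$ is the supremum of all $r\geq 0$ with the property that, for every finite set $F=\{x_1,\dots,x_n\}\subseteq rB_Y$ and every $\varepsilon>0$, there are a finite set $G=\{y_1,\dots,y_n\}\subseteq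 Y$ and $z\in\rho B_Y$ such that $\|x_j-y_j\|<\varepsilon$ for every $j\in\{1,\dots,n\}$ and $z+G\subseteq C$. A Borel set $E$ in a separable Banach space $X$ is Haar null if there is a Borel probability measure $\mu$ on $X$ such that $\mu(x+E)=0$ for every $x\in X$; it is Haar positive if it is not Haar null. *)

theory Defs
  imports "HOL-Analysis.Analysis" "HOL-Probability.Probability_Measure"
begin

type_synonym 'a dual = "'a \<Rightarrow>\<^sub>L real"
type_synonym 'a bidual = "'a dual dual"

text \<open>
  The canonical embedding of a space into its second dual is the library's
  evaluation map (see \<open>canonical_embed_apply\<close>).
\<close>

definition canonical_embed :: "'a::real_normed_vector \<Rightarrow> 'a bidual" where
  "canonical_embed = blinfun.prod_left"

lemma canonical_embed_apply: "blinfun_apply (canonical_embed x) f = blinfun_apply f x"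
  by (simp add: canonical_embed_def)

text \<open>
  For scalar-valued operators the strong operator topology is the topology of pointwise
  convergence on the predual, so on the dual of a space it is the weak$^*$ topology.
\<close>

abbreviation weak_star_topology :: "'b::real_normed_vector dual topology" where
  "weak_star_topology \<equiv> strong_operator_topology"

definition wstar_cl :: "'a::real_normed_vector set \<Rightarrow> 'a bidual set" where
  "wstar_cl C = weak_star_topology closure_of (canonical_embed ` C)"

text \<open>
  Both radii are suprema of sets of nonnegative reals which may be unbounded or empty. They
  are taken in \<^typ>\<open>ereal\<close>, so the supremum of the empty set is \<open>-\<infinity>\<close>, not \<open>0\<close>. The value
  \<open>0\<close> thus carries information: the inner radius of \<open>C\<close> is nonnegative iff \<open>C\<close> meets the ball of radius
  \<open>\<rho>\<close> around \<open>0\<close>, and the loose radius is nonnegative iff \<open>C\<close> has distance \<open>0\<close> from that ball.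
\<close>

definition inner_radius :: "'b::real_normed_vector set \<Rightarrow> real \<Rightarrow> ereal" where
  "inner_radius C \<rho> = Sup {ereal r | r. 0 \<le> r \<and> (\<exists>x \<in> cball 0 \<rho>. cball x r \<subseteq> C)}"

text \<open>
  The points $y_j$ close to the $x_j$ are given by a map \<open>y\<close> on \<open>F\<close>, with \<open>G = y ` F\<close>.
\<close>

definition loose_radius :: "'b::real_normed_vector set \<Rightarrow> real \<Rightarrow> ereal" where
  "loose_radius C \<rho> =
     Sup {ereal r | r. 0 \<le> r \<and>
       (\<forall>F. finite F \<and> F \<subseteq> cball 0 r \<longrightarrow>
         (\<forall>\<epsilon>>0. \<exists>y. \<exists>z \<in> cball 0 \<rho>.
            (\<forall>x\<in>F. norm (x - y x) < \<epsilon>) \<and> (+) z ` y ` F \<subseteq> C))}"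

text \<open>Haar null and Haar positive sets are Borel by definition.\<close>

definition haar_null :: "'a::real_normed_vector set \<Rightarrow> bool" where
  "haar_null E \<longleftrightarrow> E \<in> sets borel \<and>
     (\<exists>\<mu>::'a measure. prob_space \<mu> \<and> sets \<mu> = sets borel \<and> (\<forall>x. emeasure \<mu> ((+) x ` E) = 0))"

definition haar_positive :: "'a::real_normed_vector set \<Rightarrow> bool" where
  "haar_positive E \<longleftrightarrow> E \<in> sets borel \<and> \<not> haar_null E"

end

theory Submission
  imports Defs "HOL-Analysis.Finite_Function_Topology"
    "HOL-Probability.Infinite_Product_Measure" "HOL-Probability.Probability_Mass_Function"
begin

text \<open>
  By Hahn-Banach, all three assertions are equivalent to one inequality on \<open>X\<^sup>*\<close>: whenever \<open>f\<^sub>j \<le> b\<^sub>j\<close> on \<open>C\<close>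
  for finitely many functionals, \<open>r \<Sum>\<parallel>f\<^sub>j\<parallel> \<le> \<Sum>b\<^sub>j + \<rho> \<parallel>\<Sum>f\<^sub>j\<parallel>\<close>. Indeed it is
  the consistency condition for extending the requirements \<open>z\<^sub>0(f) \<le> \<rho>\<parallel>f\<parallel>\<close> and \<open>z\<^sub>0(f) \<le> b - r\<parallel>f\<parallel>\<close>
  to a linear functional \<open>z\<^sub>0\<close> on \<open>X\<^sup>*\<close>, so no weak* compactness is needed.

  If the inequality holds for some \<open>r > 0\<close>, every compact subset of the ball of radius \<open>r/2\<close> has a translate
  inside \<open>C\<close>: approximate translates have compact error sets, and the errors are rescaled and translated again.
  Since Borel probability measures are tight, \<open>C\<close> is not Haar null. If the inequality fails for
  all \<open>r > 0\<close> and \<open>\<rho>\<close>, there are at every scale finitely supported measures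
  giving mass at most \<open>1/2\<close> to all bounded translates of a neighbourhood of \<open>C\<close>; the distribution of a sum of
  independent variables at rapidly decreasing scales is a measure vanishing on all translates of \<open>C\<close>.
\<close>

section \<open>Hahn-Banach separation\<close>

text \<open>This is Hahn-Banach for a cone \<open>G\<close> of constraints
  \<open>f v \<le> t\<close>: the only obstruction is a constraint on \<open>0\<close> with negative
  right side. Zorn's lemma gives a maximal consistent cone \<open>M\<close>, and maximality forces
  its lower boundary \<open>p\<close> to be linear.\<close>

lemma dominated_linear_exists:
  fixes G :: "('v::real_vector \<times> real) set"
  assumes add: "\<And>a b. a \<in> G \<Longrightarrow> b \<in> G \<Longrightarrow> a + b \<in> G"
    and scale: "\<And>c a. c > 0 \<Longrightarrow> a \<in> G \<Longrightarrow> c *\<^sub>R a \<in> G"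
    and total: "\<And>v. \<exists>t. (v, t) \<in> G"
    and zero: "\<And>t. (0, t) \<in> G \<Longrightarrow> t \<ge> 0"
  shows "\<exists>f. linear f \<and> (\<forall>v t. (v, t) \<in> G \<longrightarrow> f v \<le> t)"
proof -
  define A where "A = {H. G \<subseteq> H \<and> (\<forall>a\<in>H. \<forall>b\<in>H. a + b \<in> H)
      \<and> (\<forall>c>0. \<forall>a\<in>H. c *\<^sub>R a \<in> H) \<and> (\<forall>t. (0, t) \<in> H \<longrightarrow> t \<ge> 0)}"
  have "\<exists>M\<in>A. \<forall>X\<in>A. M \<subseteq> X \<longrightarrow> X = M"
  proof (rule subset_Zorn_nonempty)
    have "G \<in> A" using assms by (auto simp: A_def)
    then show "A \<noteq> {}" by auto
  next
    fix \<C> assume ne: "\<C> \<noteq> {}" and ch: "subset.chain A \<C>"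
    have sub: "\<C> \<subseteq> A" using ch by (simp add: subset.chain_def)
    have "a + b \<in> \<Union>\<C>" if ab: "a \<in> \<Union>\<C>" "b \<in> \<Union>\<C>" for a b
    proof -
      obtain H K where HK: "H \<in> \<C>" "K \<in> \<C>" "a \<in> H" "b \<in> K" using ab by auto
      then have "H \<subseteq> K \<or> K \<subseteq> H" using ch by (meson subset_chain_def)
      then obtain L where "L \<in> \<C>" "a \<in> L" "b \<in> L" using HK by blast
      then show ?thesis using sub unfolding A_def by blast
    qed
    moreover have "G \<subseteq> \<Union>\<C>"
    proof -
      obtain H where "H \<in> \<C>" using ne by blast
      then show ?thesis using sub unfolding A_def by blast
    qed
    moreover have "c *\<^sub>R a \<in> \<Union>\<C>" if "c > 0" "a \<in> \<Union>\<C>" for c :: real and a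
      using sub that unfolding A_def by blast
    moreover have "t \<ge> 0" if "(0, t) \<in> \<Union>\<C>" for t
      using sub that unfolding A_def by blast
    ultimately show "\<Union>\<C> \<in> A" by (simp add: A_def)
  qed
  then obtain M where "M \<in> A" and max: "\<And>X. X \<in> A \<Longrightarrow> M \<subseteq> X \<Longrightarrow> X = M" by auto
  then have GM: "G \<subseteq> M" and Madd: "\<And>a b. a \<in> M \<Longrightarrow> b \<in> M \<Longrightarrow> a + b \<in> M"
    and Mscale: "\<And>c a. c > 0 \<Longrightarrow> a \<in> M \<Longrightarrow> c *\<^sub>R a \<in> M"
    and Mzero: "\<And>t. (0, t) \<in> M \<Longrightarrow> t \<ge> 0"
    by (auto simp: A_def)
  define p where "p v = Inf {t. (v, t) \<in> M}" for v
  have ne: "{t. (v, t) \<in> M} \<noteq> {}" for v using total GM by blast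
  have bdd: "bdd_below {t. (v, t) \<in> M}" for v
  proof -
    obtain t' where t': "(- v, t') \<in> M" using ne[of "- v"] by auto
    have "- t' \<le> t" if "(v, t) \<in> M" for t
      using Mzero[of "t + t'"] Madd[OF that t'] by simp
    then show ?thesis by (intro bdd_belowI[of _ "- t'"]) auto
  qed
  have lower: "p v \<le> t" if "(v, t) \<in> M" for v t
    unfolding p_def using bdd that by (intro cInf_lower) auto
  have greatest: "s \<le> p v" if "\<And>t. (v, t) \<in> M \<Longrightarrow> s \<le> t" for v s
    unfolding p_def using ne that by (intro cInf_greatest) auto
  have sub: "p (v + w) \<le> p v + p w" for v w
  proof -
    have "p (v + w) - t \<le> p w" if "(v, t) \<in> M" for t
    proof (rule greatest)
      fix u assume "(w, u) \<in> M"
      from Madd[OF that this] have "p (v + w) \<le> t + u" by (intro lower) simp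
      then show "p (v + w) - t \<le> u" by simp
    qed
    then have "p (v + w) - p w \<le> p v" by (intro greatest) (auto simp: algebra_simps)
    then show ?thesis by simp
  qed
  have scale_le: "p (c *\<^sub>R v) \<le> c * p v" if c: "c > 0" for c v
  proof -
    have "p (c *\<^sub>R v) / c \<le> p v"
    proof (rule greatest)
      fix t assume "(v, t) \<in> M"
      from Mscale[OF c this] have "p (c *\<^sub>R v) \<le> c * t" by (intro lower) simp
      then show "p (c *\<^sub>R v) / c \<le> t" using c by (simp add: field_simps)
    qed
    then show ?thesis using c by (simp add: field_simps)
  qed
  have scale_pos: "p (c *\<^sub>R v) = c * p v" if c: "c > 0" for c v
  proof (rule antisym)
    have "p (inverse c *\<^sub>R (c *\<^sub>R v)) \<le> inverse c * p (c *\<^sub>R v)" using c by (intro scale_le) simp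
    then show "c * p v \<le> p (c *\<^sub>R v)" using c by (simp add: field_simps)
  qed (use c scale_le in simp)
  have minus: "p (v - y) \<le> p v - p y" for v y
  proof -
    \<comment> \<open>\<open>M'\<close> adds the constraint \<open>f (- y) \<le> - p y\<close>. It
      stays consistent: a constraint on \<open>0\<close> arises from \<open>w = s y\<close>, where
      \<open>t \<ge> p (s y) = s p y\<close>. By maximality the new constraint is already in
      \<open>M\<close>, which makes \<open>p\<close> superadditive as well.\<close>
    define M' where "M' = {(w - s *\<^sub>R y, t - s * p y) | w t s. (w, t) \<in> M \<and> s \<ge> 0}"
    have MM': "M \<subseteq> M'"
    proof clarify
      fix w t assume "(w, t) \<in> M"
      then show "(w, t) \<in> M'" unfolding M'_def
        by (intro CollectI exI[of _ w] exI[of _ t] exI[of _ 0]) simp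
    qed
    have "M' \<in> A"
      unfolding A_def
    proof (intro CollectI conjI ballI allI impI)
      show "G \<subseteq> M'" using GM MM' by simp
    next
      fix a b assume "a \<in> M'" "b \<in> M'"
      then obtain w t s w' t' s' where
        "a = (w - s *\<^sub>R y, t - s * p y)" "(w, t) \<in> M" "s \<ge> 0"
        "b = (w' - s' *\<^sub>R y, t' - s' * p y)" "(w', t') \<in> M" "s' \<ge> 0"
        unfolding M'_def by blast
      then show "a + b \<in> M'" unfolding M'_def using Madd[of "(w, t)" "(w', t')"]
        by (intro CollectI exI[of _ "w + w'"] exI[of _ "t + t'"] exI[of _ "s + s'"])
          (simp add: algebra_simps)
    next
      fix c :: real and a assume c: "c > 0" and "a \<in> M'"
      then obtain w t s where
        "a = (w - s *\<^sub>R y, t - s * p y)" "(w, t) \<in> M" "s \<ge> 0"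
        unfolding M'_def by blast
      then show "c *\<^sub>R a \<in> M'" unfolding M'_def using Mscale[OF c, of "(w, t)"] c
        by (intro CollectI exI[of _ "c *\<^sub>R w"] exI[of _ "c * t"] exI[of _ "c * s"])
          (simp add: algebra_simps)
    next
      fix t0 assume "(0, t0) \<in> M'"
      then obtain w t s where w: "w = s *\<^sub>R y" "t0 = t - s * p y" "(w, t) \<in> M" "s \<ge> 0"
        unfolding M'_def by auto
      show "0 \<le> t0"
      proof (cases "s = 0")
        case True then show ?thesis using w Mzero by simp
      next
        case False
        then show ?thesis using lower[OF w(3)] scale_pos[of s y] w by simp
      qed
    qed
    then have "M' = M" using max MM' by simp
    have "p (v - y) + p y \<le> t" if "(v, t) \<in> M" for t
    proof -
      have "(v - 1 *\<^sub>R y, t - 1 * p y) \<in> M'" unfolding M'_def using that zero_le_one by blast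
      then show ?thesis using lower \<open>M' = M\<close> by fastforce
    qed
    then have "p (v - y) + p y \<le> p v" by (rule greatest)
    then show ?thesis by simp
  qed
  have padd: "p (v + w) = p v + p w" for v w
    using sub[of v w] minus[of "v + w" w] by simp
  then have p0: "p 0 = 0" by (metis add_cancel_left_left)
  have pneg: "p (- v) = - p v" for v using padd[of v "- v"] p0 by simp
  have "p (c *\<^sub>R v) = c * p v" for c v
    using scale_pos[of c v] scale_pos[of "- c" v] p0 pneg[of "c *\<^sub>R v"]
    by (cases "c > 0"; cases "c = 0") auto
  then have "linear p" using padd by (intro linearI) auto
  moreover have "p v \<le> t" if "(v, t) \<in> G" for v t using that GM lower by blast
  ultimately show ?thesis by blast
qed

lemma blinfun_of_linear:
  fixes f :: "'v::real_normed_vector \<Rightarrow> real"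
  assumes "linear f" "\<And>v. f v \<le> K * norm v" "K \<ge> 0"
  obtains \<phi> :: "'v \<Rightarrow>\<^sub>L real" where "blinfun_apply \<phi> = f" "norm \<phi> \<le> K"
proof -
  have le: "\<bar>f v\<bar> \<le> K * norm v" for v
    using assms(2)[of v] assms(2)[of "- v"] linear_neg[OF assms(1), of v] by simp
  then have bl: "bounded_linear f"
    using assms(1) by (intro bounded_linear_intro[of f K])
      (auto simp: linear_add linear_scale mult.commute)
  have app: "blinfun_apply (Blinfun f) = f" using bl by (simp add: bounded_linear_Blinfun_apply)
  have "norm (Blinfun f) \<le> K"
    using le assms(3) by (intro norm_blinfun_bound) (auto simp: app)
  then show ?thesis using app that by blast
qed

text \<open>The requirements \<open>\<phi> v \<le> norm v\<close> and
  \<open>\<phi> (- d) \<le> - e\<close> generate the cone \<open>G\<close>, by writing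
  \<open>v = (v + s d) + s (- d)\<close>. A constraint on \<open>0\<close> has right side at least
  \<open>norm (s d) - s e\<close>, which is nonnegative, so they are consistent.\<close>

lemma separation_from_ball:
  fixes D :: "'v::real_normed_vector set"
  assumes "convex D" "D \<noteq> {}" and far: "\<And>d. d \<in> D \<Longrightarrow> norm d \<ge> e"
  obtains \<phi> :: "'v \<Rightarrow>\<^sub>L real" where "norm \<phi> \<le> 1" "\<And>d. d \<in> D \<Longrightarrow> \<phi> d \<ge> e"
proof -
  define G where "G = {(v, t) | v t. \<exists>s\<ge>0. \<exists>d\<in>D. norm (v + s *\<^sub>R d) - s * e \<le> t}"
  have "\<exists>f. linear f \<and> (\<forall>v t. (v, t) \<in> G \<longrightarrow> f v \<le> t)"
  proof (rule dominated_linear_exists)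
    fix a b assume "a \<in> G" "b \<in> G"
    then obtain v t s d v' t' s' d' where
      a: "a = (v, t)" "s \<ge> 0" "d \<in> D" "norm (v + s *\<^sub>R d) - s * e \<le> t" and
      b: "b = (v', t')" "s' \<ge> 0" "d' \<in> D" "norm (v' + s' *\<^sub>R d') - s' * e \<le> t'"
      unfolding G_def by blast
    \<comment> \<open>Convexity merges two multiples of points of \<open>D\<close> into one
      multiple; if both multipliers vanish, any point of \<open>D\<close> serves.\<close>
    have "\<exists>d''\<in>D. s *\<^sub>R d + s' *\<^sub>R d' = (s + s') *\<^sub>R d''"
    proof (cases "s + s' = 0")
      case True
      then have "s = 0" "s' = 0" using a b by auto
      then show ?thesis using a by auto
    next
      case False
      then have pos: "s + s' > 0" using a b by auto
      have "(s / (s + s')) *\<^sub>R d + (s' / (s + s')) *\<^sub>R d' \<in> D"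
        using a b pos False by (intro convexD[OF assms(1)]) (auto simp: add_divide_distrib[symmetric])
      then show ?thesis using False by (intro bexI) (auto simp: scaleR_add_right)
    qed
    then obtain d'' where d'': "d'' \<in> D" "s *\<^sub>R d + s' *\<^sub>R d' = (s + s') *\<^sub>R d''" by blast
    have "norm ((v + v') + (s + s') *\<^sub>R d'') \<le> norm (v + s *\<^sub>R d) + norm (v' + s' *\<^sub>R d')"
      unfolding d''(2)[symmetric]
      using norm_triangle_ineq[of "v + s *\<^sub>R d" "v' + s' *\<^sub>R d'"] by (simp add: algebra_simps)
    then have "norm ((v + v') + (s + s') *\<^sub>R d'') - (s + s') * e \<le> t + t'"
      using a b by (simp add: algebra_simps)
    then have "\<exists>s\<ge>0. \<exists>d\<in>D. norm ((v + v') + s *\<^sub>R d) - s * e \<le> t + t'"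
      using d''(1) a(2) b(2) by (intro exI[of _ "s + s'"]) auto
    then show "a + b \<in> G" unfolding G_def a b by simp
  next
    fix c :: real and a assume c: "c > 0" and "a \<in> G"
    then obtain v t s d where
      a: "a = (v, t)" "s \<ge> 0" "d \<in> D" "norm (v + s *\<^sub>R d) - s * e \<le> t"
      unfolding G_def by blast
    have "norm (c *\<^sub>R v + (c * s) *\<^sub>R d) = c * norm (v + s *\<^sub>R d)"
      using c by (metis abs_of_pos norm_scaleR scaleR_add_right scaleR_scaleR)
    then have "norm (c *\<^sub>R v + (c * s) *\<^sub>R d) - (c * s) * e \<le> c * t"
      using mult_left_mono[OF a(4), of c] c by (simp add: algebra_simps)
    then have "\<exists>s\<ge>0. \<exists>d\<in>D. norm (c *\<^sub>R v + s *\<^sub>R d) - s * e \<le> c * t"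
      using a c by (intro exI[of _ "c * s"]) auto
    then show "c *\<^sub>R a \<in> G" unfolding G_def a by simp
  next
    fix v :: 'v
    obtain d where "d \<in> D" using assms(2) by auto
    then have "(v, norm v) \<in> G" unfolding G_def by (auto intro!: exI[of _ 0])
    then show "\<exists>t. (v, t) \<in> G" by blast
  next
    fix t assume "(0 :: 'v, t) \<in> G"
    then obtain s d where s: "s \<ge> 0" "d \<in> D" "norm (s *\<^sub>R d) - s * e \<le> t" unfolding G_def by auto
    then have "s * norm d - s * e \<ge> 0"
      using mult_left_mono[OF far[OF s(2)] s(1)] by simp
    then show "t \<ge> 0" using s by simp
  qed
  then obtain f where f: "linear f" "\<And>v t. (v, t) \<in> G \<Longrightarrow> f v \<le> t" by blast
  have "f v \<le> 1 * norm v" for v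
    using assms(2) by (intro f(2)) (auto simp: G_def intro!: exI[of _ 0])
  then obtain \<phi> :: "'v \<Rightarrow>\<^sub>L real" where \<phi>: "blinfun_apply \<phi> = f" "norm \<phi> \<le> 1"
    using blinfun_of_linear[OF f(1)] by (metis zero_le_one)
  have "\<phi> d \<ge> e" if "d \<in> D" for d
  proof -
    have "(- d, - e) \<in> G" unfolding G_def using that by (auto intro!: exI[of _ 1] bexI[of _ d])
    then show ?thesis using f(2) linear_neg[OF f(1)] by (simp add: \<phi>) force
  qed
  then show ?thesis using \<phi>(2) that by blast
qed

section \<open>Separation of finite families of vectors\<close>

lemma lookup_scaleR: "Poly_Mapping.lookup (s *\<^sub>R g) i = s *\<^sub>R Poly_Mapping.lookup g i"
  for g :: "'i \<Rightarrow>\<^sub>0 'v::real_vector"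
proof -
  have "finite {i. s *\<^sub>R Poly_Mapping.lookup g i \<noteq> 0}"
    by (rule finite_subset[OF _ finite_keys[of g]]) (auto simp: in_keys_iff)
  then show ?thesis unfolding scaleR_poly_mapping_def by (subst Abs_poly_mapping_inverse) auto
qed

lemma norm_lookup_le: "norm (Poly_Mapping.lookup g i) \<le> norm g"
  for g :: "'i \<Rightarrow>\<^sub>0 'v::real_normed_vector"
proof (cases "i \<in> Poly_Mapping.keys g")
  case True
  have "norm g = (\<Sum>k\<in>Poly_Mapping.keys g. norm (Poly_Mapping.lookup g k))"
    by (simp add: norm_poly_mapping_def dist_poly_mapping_def)
  then show ?thesis
    using member_le_sum[OF True, of "\<lambda>k. norm (Poly_Mapping.lookup g k)"] by simp
qed (simp add: in_keys_iff)

text \<open>Restricted to \<open>I\<close>, the families map linearly under \<open>J\<close> to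
  finitely supported functions with the sum norm, which dominates every coordinate. A functional
  separating the image of \<open>A\<close> from a ball around the origin splits into functionals of
  the coordinates.\<close>

lemma separation_family:
  fixes A :: "('i \<Rightarrow> 'v::real_normed_vector) set"
  assumes I: "finite I" and ne: "A \<noteq> {}"
    and conv: "\<And>u v s t. u \<in> A \<Longrightarrow> v \<in> A \<Longrightarrow> s \<ge> 0 \<Longrightarrow> t \<ge> 0 \<Longrightarrow> s + t = 1 \<Longrightarrow>
        (\<lambda>i. s *\<^sub>R u i + t *\<^sub>R v i) \<in> A"
    and far: "\<And>u. u \<in> A \<Longrightarrow> \<exists>i\<in>I. norm (u i) \<ge> e"
  obtains \<phi> :: "'i \<Rightarrow> 'v \<Rightarrow>\<^sub>L real" where "\<And>u. u \<in> A \<Longrightarrow> (\<Sum>i\<in>I. \<phi> i (u i)) \<ge> e"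
proof -
  define J where "J u = (\<Sum>i\<in>I. Poly_Mapping.single i (u i))" for u :: "'i \<Rightarrow> 'v"
  have lookJ: "Poly_Mapping.lookup (J u) i = u i" if "i \<in> I" for u i
    using that I by (simp add: J_def lookup_sum lookup_single when_def)
  have scale_single: "s *\<^sub>R Poly_Mapping.single i x = Poly_Mapping.single i (s *\<^sub>R x)"
    for s i and x :: 'v
    by (rule poly_mapping_eqI) (simp add: lookup_scaleR lookup_single when_def)
  have J_lin: "s *\<^sub>R J u + t *\<^sub>R J v = J (\<lambda>i. s *\<^sub>R u i + t *\<^sub>R v i)" for s t u v
    by (simp add: J_def scaleR_sum_right scale_single single_add sum.distrib)
  have convJ: "convex (J ` A)"
    using conv by (force intro!: convexI simp: J_lin)
  have farJ: "norm d \<ge> e" if "d \<in> J ` A" for d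
  proof -
    obtain u where u: "u \<in> A" "d = J u" using \<open>d \<in> J ` A\<close> by blast
    then obtain i where "i \<in> I" "norm (u i) \<ge> e" using far by blast
    then show ?thesis using norm_lookup_le[of d i] lookJ[of i u] u by simp
  qed
  obtain \<Phi> :: "('i \<Rightarrow>\<^sub>0 'v) \<Rightarrow>\<^sub>L real" where \<Phi>: "norm \<Phi> \<le> 1" "\<And>d. d \<in> J ` A \<Longrightarrow> \<Phi> d \<ge> e"
    using separation_from_ball[OF convJ _ farJ] ne by auto
  have bl: "bounded_linear (\<lambda>x. \<Phi> (Poly_Mapping.single i x))" for i
  proof (rule bounded_linear_intro[where K = "norm \<Phi>"])
    fix x :: 'v
    have "norm (Poly_Mapping.single i x) \<le> norm x"
      unfolding norm_poly_mapping_def dist_poly_mapping_def by (cases "x = 0") simp_all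
    then have "norm \<Phi> * norm (Poly_Mapping.single i x) \<le> norm \<Phi> * norm x"
      by (intro mult_left_mono) auto
    then show "norm (\<Phi> (Poly_Mapping.single i x)) \<le> norm x * norm \<Phi>"
      using norm_blinfun[of \<Phi> "Poly_Mapping.single i x"] by (simp add: mult.commute)
  qed (auto simp: single_add blinfun.add_right scale_single[symmetric] blinfun.scaleR_right)
  define \<phi> where "\<phi> i = Blinfun (\<lambda>x. \<Phi> (Poly_Mapping.single i x))" for i
  have "\<phi> i x = \<Phi> (Poly_Mapping.single i x)" for i x
    unfolding \<phi>_def using bl by (simp add: bounded_linear_Blinfun_apply)
  then have "(\<Sum>i\<in>I. \<phi> i (u i)) = \<Phi> (J u)" for u
    by (simp add: J_def blinfun.sum_right)
  then show ?thesis using \<Phi>(2) that by (metis imageI)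
qed


section \<open>The dual form of the ball condition\<close>

lemma weak_star_nhds_basis:
  fixes z :: "'b::real_normed_vector dual"
  assumes "openin weak_star_topology T" "z \<in> T"
  obtains I e where "finite I" "e > 0" "{w. \<forall>i\<in>I. \<bar>blinfun_apply w i - z i\<bar> < e} \<subseteq> T"
proof -
  obtain U where U: "open U" "T = blinfun_apply -` U"
    using assms(1) by (auto simp: strong_operator_topology_def openin_pullback_topology)
  have "openin (product_topology (\<lambda>_. euclidean) UNIV) U"
    using U(1) by (simp add: open_fun_def)
  from product_topology_open_contains_basis[OF this, of "blinfun_apply z"]
  obtain X where X: "blinfun_apply z \<in> (\<Pi>\<^sub>E i\<in>UNIV. X i)" "\<And>i. open (X i)"
      "finite {i. X i \<noteq> UNIV}" "(\<Pi>\<^sub>E i\<in>UNIV. X i) \<subseteq> U"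
    using assms(2) U(2) by auto
  define I where "I = {i. X i \<noteq> UNIV}"
  have "\<exists>e>0. ball (z i) e \<subseteq> X i" for i
  proof -
    have "z i \<in> X i" using X(1) by (auto simp: PiE_iff)
    then show ?thesis using X(2)[of i] by (meson open_contains_ball)
  qed
  then obtain e where e: "\<And>i. e i > (0::real)" "\<And>i. ball (z i) (e i) \<subseteq> X i" by metis
  \<comment> \<open>The inserted \<open>1\<close> keeps the minimum defined and positive when
    \<open>I\<close> is empty.\<close>
  define d where "d = Min (insert 1 (e ` I))"
  have fin: "finite I" using X(3) by (simp add: I_def)
  have "d > 0" using fin e(1) by (simp add: d_def)
  moreover have "{w. \<forall>i\<in>I. \<bar>blinfun_apply w i - z i\<bar> < d} \<subseteq> T"
  proof clarify
    fix w assume w: "\<forall>i\<in>I. \<bar>blinfun_apply w i - z i\<bar> < d"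
    have "w i \<in> X i" for i
    proof (cases "i \<in> I")
      case True
      then have "d \<le> e i" using fin by (simp add: d_def)
      then have "w i \<in> ball (z i) (e i)" using w True by (force simp: dist_real_def)
      then show ?thesis using e(2) by blast
    qed (simp add: I_def)
    then show "w \<in> T" using X(4) U(2) by (auto simp: PiE_iff)
  qed
  ultimately show ?thesis using that fin by blast
qed

text \<open>Half-spaces given by functionals on the original space are weak-star closed. Conversely,
  a point outside the closure has a neighbourhood that tests finitely many functionals and misses
  \<open>C\<close>; separating their values on \<open>C\<close> from those at \<open>z\<close>
  combines them into a single functional.\<close>

lemma mem_wstar_cl_iff:
  fixes C :: "'a::real_normed_vector set"
  assumes "convex C" "C \<noteq> {}"
  shows "z \<in> wstar_cl C \<longleftrightarrow> (\<forall>f b. (\<forall>c\<in>C. blinfun_apply f c \<le> b) \<longrightarrow> blinfun_apply z f \<le> b)"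
proof (intro iffI allI impI)
  fix f :: "'a dual" and b
  assume z: "z \<in> wstar_cl C" and fb: "\<forall>c\<in>C. blinfun_apply f c \<le> b"
  have "closedin weak_star_topology {w \<in> topspace weak_star_topology. blinfun_apply w f \<in> {..b}}"
    by (rule closedin_continuous_map_preimage[OF strong_operator_topology_continuous_evaluation]) simp
  moreover have "canonical_embed ` C \<subseteq> {w \<in> topspace weak_star_topology. blinfun_apply w f \<in> {..b}}"
    using fb by (auto simp: canonical_embed_apply strong_operator_topology_topspace)
  ultimately show "z f \<le> b"
    using z closure_of_minimal unfolding wstar_cl_def by fastforce
next
  assume R: "\<forall>f b. (\<forall>c\<in>C. blinfun_apply f c \<le> b) \<longrightarrow> z f \<le> b"
  show "z \<in> wstar_cl C"
  proof (rule ccontr)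
    assume "z \<notin> wstar_cl C"
    then obtain T where T: "openin weak_star_topology T" "z \<in> T" "\<And>c. c \<in> C \<Longrightarrow> canonical_embed c \<notin> T"
      unfolding wstar_cl_def in_closure_of by (auto simp: strong_operator_topology_topspace)
    obtain I e where I: "finite I" "e > 0" "{w. \<forall>i\<in>I. \<bar>blinfun_apply w i - z i\<bar> < e} \<subseteq> T"
      using weak_star_nhds_basis[OF T(1,2)] .
    define A where "A = (\<lambda>c i. blinfun_apply i c - z i) ` C"
    have "\<exists>\<phi> :: 'a dual \<Rightarrow> real \<Rightarrow>\<^sub>L real. \<forall>u\<in>A. (\<Sum>i\<in>I. \<phi> i (u i)) \<ge> e"
    proof (rule separation_family[OF I(1), of A e])
      fix u v s t assume uv: "u \<in> A" "v \<in> A" and st: "(s::real) \<ge> 0" "t \<ge> 0" "s + t = 1"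
      then obtain c d where cd: "c \<in> C" "d \<in> C" "u = (\<lambda>i. blinfun_apply i c - z i)" "v = (\<lambda>i. blinfun_apply i d - z i)"
        by (auto simp: A_def)
      have "s * z i + t * z i = z i" for i using st(3) by (simp flip: distrib_right)
      then have "(\<lambda>i. s *\<^sub>R u i + t *\<^sub>R v i) = (\<lambda>i. blinfun_apply i (s *\<^sub>R c + t *\<^sub>R d) - z i)"
        by (simp add: cd fun_eq_iff blinfun.add_right blinfun.scaleR_right algebra_simps)
      then show "(\<lambda>i. s *\<^sub>R u i + t *\<^sub>R v i) \<in> A"
        using convexD[OF assms(1) cd(1,2) st] by (auto simp: A_def)
    next
      fix u assume "u \<in> A"
      then obtain c where c: "c \<in> C" "u = (\<lambda>i. blinfun_apply i c - z i)" by (auto simp: A_def)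
      then have "canonical_embed c \<notin> {w. \<forall>i\<in>I. \<bar>blinfun_apply w i - z i\<bar> < e}" using T(3) I(3) by blast
      then show "\<exists>i\<in>I. norm (u i) \<ge> e" by (auto simp: c canonical_embed_apply not_less)
    qed (use assms(2) A_def in auto)
    then obtain \<phi> :: "'a dual \<Rightarrow> real \<Rightarrow>\<^sub>L real"
      where \<phi>: "\<And>c. c \<in> C \<Longrightarrow> (\<Sum>i\<in>I. \<phi> i (blinfun_apply i c - z i)) \<ge> e"
      by (auto simp: A_def)
    \<comment> \<open>Separation bounds the combination from below, so the sign is reversed to get
      an upper bound on \<open>C\<close>. A functional on the reals is multiplication by its value
      at \<open>1\<close>.\<close>
    define g where "g = (\<Sum>i\<in>I. (- \<phi> i 1) *\<^sub>R i)"
    have mult: "\<phi> i t = \<phi> i 1 * t" for i t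
      using blinfun.scaleR_right[of "\<phi> i" t 1] by simp
    have zg: "z g = - (\<Sum>i\<in>I. \<phi> i (z i))"
      by (simp add: g_def blinfun.sum_right blinfun.scaleR_right sum_negf blinfun.minus_right mult[of _ "z _"])
    have "g c \<le> z g - e" if "c \<in> C" for c
    proof -
      have "g c = - (\<Sum>i\<in>I. \<phi> i (blinfun_apply i c))"
        by (simp add: g_def blinfun.sum_left blinfun.scaleR_left sum_negf blinfun.minus_left mult[of _ "blinfun_apply _ c"])
      then show ?thesis using \<phi>[OF that] zg by (simp add: blinfun.diff_right sum_subtractf)
    qed
    then have "z g \<le> z g - e" using R by blast
    then show False using I(2) by simp
  qed
qed

definition supports :: "'a::real_normed_vector set \<Rightarrow> ('a dual \<times> real) list \<Rightarrow> bool" where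
  "supports C L \<longleftrightarrow> (\<forall>(f, b) \<in> set L. \<forall>c\<in>C. blinfun_apply f c \<le> b)"

text \<open>With lists a functional may recur with various bounds, and adding two instances is
  concatenation.\<close>

definition ball_condition :: "'a::real_normed_vector set \<Rightarrow> real \<Rightarrow> real \<Rightarrow> bool" where
  "ball_condition C \<rho> r \<longleftrightarrow> (\<forall>L. supports C L \<longrightarrow>
     r * (\<Sum>(f, b)\<leftarrow>L. norm f) \<le> (\<Sum>(f, b)\<leftarrow>L. b) + \<rho> * norm (\<Sum>(f, b)\<leftarrow>L. f))"

lemma almost_norming_vector:
  fixes f :: "'a::real_normed_vector dual"
  assumes "r \<ge> 0" "\<delta> > 0"
  obtains x where "norm x \<le> r" "f x \<ge> r * norm f - \<delta>"
proof (cases "r * norm f - \<delta> \<le> 0")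
  case True
  then show ?thesis using that[of 0] assms by simp
next
  case False
  then have r: "r > 0" using assms by (cases "r = 0") auto
  have "\<exists>x. \<not> norm (f x) \<le> (norm f - \<delta> / r) * norm x"
  proof (rule ccontr)
    assume "\<not> ?thesis"
    then have "norm f \<le> norm f - \<delta> / r"
      using False r by (intro norm_blinfun_bound) (auto simp: field_simps)
    then show False using assms r by (simp add: field_simps)
  qed
  then obtain x where x: "norm (f x) > (norm f - \<delta> / r) * norm x" by (auto simp: not_le)
  then have x0: "x \<noteq> 0" by auto
  define y where "y = (sgn (f x) * r / norm x) *\<^sub>R x"
  have fx0: "f x \<noteq> 0"
  proof
    assume "f x = 0"
    then have "(norm f - \<delta> / r) * norm x < 0" using x by simp
    moreover have "norm f - \<delta> / r \<ge> 0" using False r by (simp add: field_simps)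
    ultimately show False by (simp add: mult_less_0_iff)
  qed
  have "norm y \<le> r" using x0 r by (simp add: y_def norm_sgn abs_mult fx0)
  moreover have "f y = r / norm x * \<bar>f x\<bar>"
    by (simp add: y_def blinfun.scaleR_right abs_sgn mult.commute mult.left_commute)
  moreover have "r * norm f - \<delta> \<le> r / norm x * \<bar>f x\<bar>"
  proof -
    have "r * ((norm f - \<delta> / r) * norm x) \<le> r * \<bar>f x\<bar>" using x r by (intro mult_left_mono) auto
    then have "(r * norm f - \<delta>) * norm x \<le> r * \<bar>f x\<bar>" using r by (simp add: algebra_simps)
    then show ?thesis using x0 by (simp add: pos_le_divide_eq)
  qed
  ultimately show ?thesis using that by simp
qed

text \<open>Test the translation on vectors almost norming the functionals of the list, add up, and
  bound \<open>z\<close> at the total functional by \<open>\<rho>\<close> times its norm. Stated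
  through half-spaces and the second dual, the hypothesis covers both approximate translates into
  \<open>C\<close> and exact ones into the weak-star closure.\<close>

lemma ball_condition_of_approximate_translates:
  fixes C :: "'a::real_normed_vector set"
  assumes r: "r \<ge> 0"
    and H: "\<And>F \<epsilon>. finite F \<Longrightarrow> F \<subseteq> cball 0 r \<Longrightarrow> \<epsilon> > 0 \<Longrightarrow>
      \<exists>z \<in> cball (0 :: 'a bidual) \<rho>. \<forall>x\<in>F. \<forall>f b.
        (\<forall>c\<in>C. blinfun_apply f c \<le> b) \<longrightarrow> blinfun_apply z f + blinfun_apply f x \<le> b + \<epsilon> * norm f"
  shows "ball_condition C \<rho> r"
  unfolding ball_condition_def
proof (intro allI impI)
  fix L :: "('a dual \<times> real) list" assume L: "supports C L"
  define S where "S = (\<Sum>(f, b)\<leftarrow>L. norm f)"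
  have S0: "S \<ge> 0" by (auto simp: S_def intro!: sum_list_nonneg)
  show "r * (\<Sum>(f, b)\<leftarrow>L. norm f) \<le> (\<Sum>(f, b)\<leftarrow>L. b) + \<rho> * norm (\<Sum>(f, b)\<leftarrow>L. f)"
  proof (rule field_le_epsilon)
    fix e :: real assume e: "e > 0"
    \<comment> \<open>Each entry loses \<open>\<delta>\<close> in almost norming and
      \<open>\<delta> * norm f\<close> in translating, in total
      \<open>(length L + S) * \<delta>\<close>; the \<open>1\<close> keeps the denominator
      positive.\<close>
    define \<delta> where "\<delta> = e / (real (length L) + S + 1)"
    have \<delta>: "\<delta> > 0" using e S0 by (simp add: \<delta>_def)
    have "\<exists>x. norm x \<le> r \<and> blinfun_apply f x \<ge> r * norm f - \<delta>" for f :: "'a dual"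
      using almost_norming_vector[OF r \<delta>] by blast
    then obtain X where X: "\<And>f :: 'a dual. norm (X f) \<le> r" "\<And>f. blinfun_apply f (X f) \<ge> r * norm f - \<delta>"
      by metis
    obtain z where z: "norm (z :: 'a bidual) \<le> \<rho>" "\<forall>x \<in> X ` fst ` set L. \<forall>f b.
        (\<forall>c\<in>C. blinfun_apply f c \<le> b) \<longrightarrow> blinfun_apply z f + blinfun_apply f x \<le> b + \<delta> * norm f"
    proof -
      have "X ` fst ` set L \<subseteq> cball 0 r" using X(1) by auto
      then show ?thesis using H[of "X ` fst ` set L" \<delta>] \<delta> that by (auto simp del: ball_simps)
    qed
    have *: "(\<Sum>(f, b)\<leftarrow>K. r * norm f - \<delta> + blinfun_apply z f) \<le> (\<Sum>(f, b)\<leftarrow>K. b + \<delta> * norm f)"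
      if "set K \<subseteq> set L" for K
      using that
    proof (induction K)
      case (Cons a K)
      obtain f b where a: "a = (f, b)" by force
      have "z f + f (X f) \<le> b + \<delta> * norm f"
        using z(2) Cons.prems L by (force simp: a supports_def)
      then show ?case using Cons X(2)[of f] by (simp add: a)
    qed simp
    have sums: "(\<Sum>(f, b)\<leftarrow>K. r * norm f - \<delta> + blinfun_apply z f) =
        r * (\<Sum>(f, b)\<leftarrow>K. norm f) - real (length K) * \<delta> + z (\<Sum>(f, b)\<leftarrow>K. f)"
      "(\<Sum>(f, b)\<leftarrow>K. b + \<delta> * norm f) = (\<Sum>(f, b)\<leftarrow>K. b) + \<delta> * (\<Sum>(f, b)\<leftarrow>K. norm f)" for K
      by (induction K) (auto simp: algebra_simps blinfun.add_right)
    have "\<bar>z (\<Sum>(f, b)\<leftarrow>L. f)\<bar> \<le> \<rho> * norm (\<Sum>(f, b)\<leftarrow>L. f)"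
      using norm_blinfun[of z "\<Sum>(f, b)\<leftarrow>L. f"] mult_right_mono[OF z(1), of "norm (\<Sum>(f, b)\<leftarrow>L. f)"] by simp
    moreover have "real (length L) * \<delta> + \<delta> * S \<le> e"
    proof -
      have "(real (length L) + S + 1) * \<delta> = e" using S0 by (simp add: \<delta>_def)
      then show ?thesis using \<delta> by (simp add: algebra_simps)
    qed
    ultimately show "r * (\<Sum>(f, b)\<leftarrow>L. norm f) \<le> (\<Sum>(f, b)\<leftarrow>L. b) + \<rho> * norm (\<Sum>(f, b)\<leftarrow>L. f) + e"
      using *[of L] unfolding sums S_def by (simp add: abs_le_iff)
  qed
qed

text \<open>One \<open>z\<close> serves the whole ball as soon as
  \<open>z f \<le> b - r * norm f\<close> whenever \<open>f \<le> b\<close> on \<open>C\<close>: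
  adding \<open>w\<close> of norm at most \<open>r\<close> then stays in every half-space containing
  \<open>C\<close>.\<close>

lemma ball_condition_imp_ball_subset:
  fixes C :: "'a::real_normed_vector set"
  assumes "convex C" "C \<noteq> {}" and \<rho>: "\<rho> \<ge> 0" and bc: "ball_condition C \<rho> r"
  obtains z where "z \<in> cball (0 :: 'a bidual) \<rho>" "(+) z ` cball 0 r \<subseteq> wstar_cl C"
proof -
  \<comment> \<open>The list collects the supporting constraints in use, and the remainder of
    \<open>g\<close> is paid for at \<open>\<rho>\<close> times its norm. The empty list yields the
    norm bound on \<open>z\<close>, a one-element list the bound at a supporting functional.\<close>
  define G where "G = {(g :: 'a dual, t) | g t. \<exists>L. supports C L \<and>
    (\<Sum>(f, b)\<leftarrow>L. b - r * norm f) + \<rho> * norm (g - (\<Sum>(f, b)\<leftarrow>L. f)) \<le> t}"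
  have "\<exists>f. linear f \<and> (\<forall>v t. (v, t) \<in> G \<longrightarrow> f v \<le> t)"
  proof (rule dominated_linear_exists)
    fix x y assume "x \<in> G" "y \<in> G"
    then obtain g t L g' t' L' where
      x: "x = (g, t)" "supports C L"
        "(\<Sum>(f, b)\<leftarrow>L. b - r * norm f) + \<rho> * norm (g - (\<Sum>(f, b)\<leftarrow>L. f)) \<le> t" and
      y: "y = (g', t')" "supports C L'"
        "(\<Sum>(f, b)\<leftarrow>L'. b - r * norm f) + \<rho> * norm (g' - (\<Sum>(f, b)\<leftarrow>L'. f)) \<le> t'"
      unfolding G_def by blast
    have "norm (g + g' - (\<Sum>(f, b)\<leftarrow>L @ L'. f))
        \<le> norm (g - (\<Sum>(f, b)\<leftarrow>L. f)) + norm (g' - (\<Sum>(f, b)\<leftarrow>L'. f))"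
      using norm_triangle_ineq[of "g - (\<Sum>(f, b)\<leftarrow>L. f)" "g' - (\<Sum>(f, b)\<leftarrow>L'. f)"]
      by (simp add: algebra_simps)
    from mult_left_mono[OF this \<rho>] have "(\<Sum>(f, b)\<leftarrow>L @ L'. b - r * norm f)
        + \<rho> * norm (g + g' - (\<Sum>(f, b)\<leftarrow>L @ L'. f)) \<le> t + t'"
      using x(3) y(3) by (simp add: algebra_simps)
    moreover have "supports C (L @ L')" using x y by (auto simp: supports_def)
    ultimately show "x + y \<in> G" unfolding G_def x y by auto
  next
    fix c :: real and x assume c: "c > 0" and "x \<in> G"
    then obtain g t L where
      x: "x = (g, t)" "supports C L"
        "(\<Sum>(f, b)\<leftarrow>L. b - r * norm f) + \<rho> * norm (g - (\<Sum>(f, b)\<leftarrow>L. f)) \<le> t"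
      unfolding G_def by blast
    define L' where "L' = map (\<lambda>(f, b). (c *\<^sub>R f, c * b)) L"
    have s1: "(\<Sum>(f, b)\<leftarrow>L'. f) = c *\<^sub>R (\<Sum>(f, b)\<leftarrow>L. f)"
      unfolding L'_def by (induction L) (auto simp: scaleR_add_right)
    have s2: "(\<Sum>(f, b)\<leftarrow>L'. b - r * norm f) = c * (\<Sum>(f, b)\<leftarrow>L. b - r * norm f)"
      unfolding L'_def using c by (induction L) (auto simp: algebra_simps)
    have "norm (c *\<^sub>R g - (\<Sum>(f, b)\<leftarrow>L'. f)) = c * norm (g - (\<Sum>(f, b)\<leftarrow>L. f))"
      unfolding s1 using c by (simp flip: scaleR_diff_right)
    then have "(\<Sum>(f, b)\<leftarrow>L'. b - r * norm f) + \<rho> * norm (c *\<^sub>R g - (\<Sum>(f, b)\<leftarrow>L'. f)) \<le> c * t"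
      using mult_left_mono[OF x(3), of c] c by (simp add: s2 algebra_simps)
    moreover have "supports C L'"
      using x(2) c by (auto simp: supports_def L'_def blinfun.scaleR_left)
    ultimately show "c *\<^sub>R x \<in> G" unfolding G_def x by auto
  next
    fix g :: "'a dual"
    have "(g, \<rho> * norm g) \<in> G" unfolding G_def by (auto simp: supports_def intro!: exI[of _ "[]"])
    then show "\<exists>t. (g, t) \<in> G" by blast
  next
    fix t assume "(0 :: 'a dual, t) \<in> G"
    then obtain L where L: "supports C L"
        "(\<Sum>(f, b)\<leftarrow>L. b - r * norm f) + \<rho> * norm (0 - (\<Sum>(f, b)\<leftarrow>L. f)) \<le> t"
      unfolding G_def by blast
    have "(\<Sum>(f, b)\<leftarrow>L. b - r * norm f) = (\<Sum>(f, b)\<leftarrow>L. b) - r * (\<Sum>(f, b)\<leftarrow>L. norm f)"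
      for L :: "('a dual \<times> real) list"
      by (induction L) (auto simp: algebra_simps)
    then show "t \<ge> 0" using L bc unfolding ball_condition_def by fastforce
  qed
  then obtain Z where Z: "linear Z" "\<And>g t. (g, t) \<in> G \<Longrightarrow> Z g \<le> t" by blast
  have "Z g \<le> \<rho> * norm g" for g
    by (intro Z(2)) (auto simp: G_def supports_def intro!: exI[of _ "[]"])
  then obtain z :: "'a bidual" where z: "blinfun_apply z = Z" "norm z \<le> \<rho>"
    using blinfun_of_linear[OF Z(1) _ \<rho>] by metis
  have zf: "z f \<le> b - r * norm f" if "\<forall>c\<in>C. blinfun_apply f c \<le> b" for f :: "'a dual" and b
    unfolding z by (intro Z(2)) (use that in \<open>auto simp: G_def supports_def intro!: exI[of _ "[(f, b)]"]\<close>)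
  have "z + w \<in> wstar_cl C" if w: "norm w \<le> r" for w
    unfolding mem_wstar_cl_iff[OF assms(1,2)]
  proof (intro allI impI)
    fix f :: "'a dual" and b assume "\<forall>c\<in>C. blinfun_apply f c \<le> b"
    moreover have "w f \<le> r * norm f"
      using norm_blinfun[of w f] mult_right_mono[OF w, of "norm f"] by simp
    ultimately show "(z + w) f \<le> b" using zf[of f b] by (simp add: blinfun.add_left)
  qed
  then have "(+) z ` cball 0 r \<subseteq> wstar_cl C" by (intro image_subsetI) simp
  then show ?thesis using that z(2) by simp
qed

text \<open>If no translation works, the error families \<open>c x - x - z\<close> stay away from
  \<open>0\<close> on \<open>F\<close>. Separating them gives functionals whose suprema
  \<open>b x\<close> over \<open>C\<close> violate \<open>ball_condition\<close>.\<close>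

lemma ball_condition_imp_approximate_translates:
  fixes C :: "'a::real_normed_vector set"
  assumes "convex C" "C \<noteq> {}" and \<rho>: "\<rho> \<ge> 0" and bc: "ball_condition C \<rho> r"
    and F: "finite F" "F \<subseteq> cball 0 r" and \<epsilon>: "\<epsilon> > 0"
  shows "\<exists>y. \<exists>z \<in> cball 0 \<rho>. (\<forall>x\<in>F. norm (x - y x) < \<epsilon>) \<and> (+) z ` y ` F \<subseteq> C"
proof (rule ccontr)
  assume neg: "\<not> ?thesis"
  define A where "A = {(\<lambda>x. c x - x - z) | c z. (\<forall>x. c x \<in> C) \<and> norm z \<le> \<rho>}"
  obtain c0 where c0: "c0 \<in> C" using assms(2) by auto
  have far: "\<exists>x\<in>F. norm (u x) \<ge> \<epsilon>" if uA: "u \<in> A" for u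
  proof (rule ccontr)
    assume "\<not> ?thesis"
    moreover obtain c z where u: "u = (\<lambda>x. c x - x - z)" "\<forall>x. c x \<in> C" "norm z \<le> \<rho>"
      using uA unfolding A_def by blast
    ultimately have "norm (x - (c x - z)) < \<epsilon>" if "x \<in> F" for x
      using that by (auto simp: not_le norm_minus_commute algebra_simps)
    then have "(\<forall>x\<in>F. norm (x - (c x - z)) < \<epsilon>) \<and> (+) z ` (\<lambda>x. c x - z) ` F \<subseteq> C"
      using u by auto
    moreover have "z \<in> cball 0 \<rho>" using u by simp
    ultimately have "\<exists>y. \<exists>z \<in> cball 0 \<rho>. (\<forall>x\<in>F. norm (x - y x) < \<epsilon>) \<and> (+) z ` y ` F \<subseteq> C"
      by (intro exI[of _ "\<lambda>x. c x - z"] bexI[of _ z])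
    then show False using neg by contradiction
  qed
  have conv: "(\<lambda>x. s *\<^sub>R u x + t *\<^sub>R v x) \<in> A"
    if uv: "u \<in> A" "v \<in> A" and st: "(s::real) \<ge> 0" "t \<ge> 0" "s + t = 1" for u v s t
  proof -
    obtain c z d w where u: "u = (\<lambda>x. c x - x - z)" "\<forall>x. c x \<in> C" "norm z \<le> \<rho>"
      and v: "v = (\<lambda>x. d x - x - w)" "\<forall>x. d x \<in> C" "norm w \<le> \<rho>"
      using uv unfolding A_def by blast
    have x: "x = s *\<^sub>R x + t *\<^sub>R x" for x :: 'a using st(3) by (simp flip: scaleR_add_left)
    have "s *\<^sub>R u x + t *\<^sub>R v x = (s *\<^sub>R c x + t *\<^sub>R d x) - x - (s *\<^sub>R z + t *\<^sub>R w)" for x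
      unfolding u v by (subst (5) x) (simp add: scaleR_diff_right)
    moreover have "\<forall>x. s *\<^sub>R c x + t *\<^sub>R d x \<in> C"
      using u v convexD[OF assms(1) _ _ st] by blast
    moreover have "norm (s *\<^sub>R z + t *\<^sub>R w) \<le> \<rho>"
      using convexD[OF convex_cball[of 0 \<rho>], of z w s t] u v st by simp
    ultimately show ?thesis unfolding A_def
      by (intro CollectI exI[of _ "\<lambda>x. s *\<^sub>R c x + t *\<^sub>R d x"] exI[of _ "s *\<^sub>R z + t *\<^sub>R w"])
        (simp add: fun_eq_iff)
  qed
  have "(\<lambda>x. c0 - x - 0) \<in> A" unfolding A_def using c0 \<rho> by fastforce
  then have "A \<noteq> {}" by blast
  then obtain \<phi> :: "'a \<Rightarrow> 'a dual" where \<phi>: "\<And>u. u \<in> A \<Longrightarrow> (\<Sum>x\<in>F. \<phi> x (u x)) \<ge> \<epsilon>"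
    using separation_family[OF F(1) _ conv far] by blast
  define f where "f x = - \<phi> x" for x
  define g where "g = (\<Sum>x\<in>F. f x)"
  have sep: "(\<Sum>x\<in>F. f x (c x)) \<le> (\<Sum>x\<in>F. f x x) + g z - \<epsilon>" if "\<And>x. c x \<in> C" "norm z \<le> \<rho>" for c z
  proof -
    have "(\<lambda>x. c x - x - z) \<in> A" using that by (auto simp: A_def)
    from \<phi>[OF this] show ?thesis
      by (simp add: g_def f_def blinfun.diff_right blinfun.minus_left blinfun.sum_left sum_subtractf sum_negf)
  qed
  \<comment> \<open>So far only the sum over \<open>F\<close> is bounded; moving one coordinate
    through \<open>C\<close> with the others fixed at \<open>c0\<close> bounds each functional
    separately.\<close>
  have bdd: "bdd_above (f x ` C)" if "x \<in> F" for x
  proof -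
    have "f x c \<le> (\<Sum>x\<in>F. f x x) + g 0 - \<epsilon> - (\<Sum>y\<in>F - {x}. f y c0)" if "c \<in> C" for c
    proof -
      have "(\<Sum>y\<in>F. f y (((\<lambda>_. c0)(x := c)) y)) \<le> (\<Sum>x\<in>F. f x x) + g 0 - \<epsilon>"
        using c0 that \<rho> by (intro sep) auto
      then show ?thesis using \<open>x \<in> F\<close> F(1) by (simp add: sum.remove)
    qed
    then show ?thesis by (auto intro!: bdd_aboveI2)
  qed
  define b where "b x = Sup (f x ` C)" for x
  \<comment> \<open>Each supremum \<open>b x\<close> costs \<open>\<delta>\<close> and almost
    norming \<open>- g\<close> costs one more, in total \<open>\<epsilon> / 2\<close>.\<close>
  define \<delta> where "\<delta> = \<epsilon> / 2 / (real (card F) + 1)"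
  have \<delta>: "\<delta> > 0" using \<epsilon> by (simp add: \<delta>_def)
  have "\<exists>c\<in>C. b x - \<delta> \<le> f x c" if "x \<in> F" for x
  proof -
    have "b x - \<delta> < b x" using \<delta> by simp
    then show ?thesis
      unfolding b_def using less_cSup_iff[OF _ bdd[OF that]] assms(2) by (force intro: less_imp_le)
  qed
  then have "\<exists>c. \<forall>x. c x \<in> C \<and> (x \<in> F \<longrightarrow> b x - \<delta> \<le> f x (c x))"
    using c0 by (intro choice) blast
  then obtain c where c: "\<And>x. c x \<in> C" "\<And>x. x \<in> F \<Longrightarrow> b x - \<delta> \<le> f x (c x)" by blast
  \<comment> \<open>This is nearly the worst translation: \<open>g z\<close> is close to
    \<open>- \<rho> * norm g\<close>, which supplies the term with \<open>\<rho>\<close> in the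
    inequality.\<close>
  obtain z where z: "norm z \<le> \<rho>" "(- g) z \<ge> \<rho> * norm (- g) - \<delta>"
    using almost_norming_vector[OF \<rho> \<delta>] .
  have "(\<Sum>x\<in>F. b x) - real (card F) * \<delta> \<le> (\<Sum>x\<in>F. f x (c x))"
    using sum_mono[OF c(2)] by (simp add: sum_subtractf)
  also have "\<dots> \<le> (\<Sum>x\<in>F. f x x) + g z - \<epsilon>" by (rule sep[OF c(1) z(1)])
  also have "\<dots> \<le> r * (\<Sum>x\<in>F. norm (f x)) - \<rho> * norm g + \<delta> - \<epsilon>"
  proof -
    have "f x x \<le> r * norm (f x)" if "x \<in> F" for x
      using norm_blinfun[of "f x" x] F(2) that mult_left_mono[of "norm x" r "norm (f x)"]
      by (auto simp: mult.commute)
    then have "(\<Sum>x\<in>F. f x x) \<le> r * (\<Sum>x\<in>F. norm (f x))" by (simp add: sum_distrib_left sum_mono)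
    then show ?thesis using z(2) by (simp add: blinfun.minus_left)
  qed
  finally have 1: "(\<Sum>x\<in>F. b x) + \<rho> * norm g \<le> r * (\<Sum>x\<in>F. norm (f x)) + (real (card F) + 1) * \<delta> - \<epsilon>"
    by (simp add: algebra_simps)
  obtain xs where xs: "set xs = F" "distinct xs" using finite_distinct_list[OF F(1)] by blast
  define L where "L = map (\<lambda>x. (f x, b x)) xs"
  have "supports C L"
    unfolding supports_def L_def using bdd xs by (auto simp: b_def intro: cSup_upper)
  then have "r * (\<Sum>(f, b)\<leftarrow>L. norm f) \<le> (\<Sum>(f, b)\<leftarrow>L. b) + \<rho> * norm (\<Sum>(f, b)\<leftarrow>L. f)"
    using bc by (simp add: ball_condition_def)
  then have "r * (\<Sum>x\<in>F. norm (f x)) \<le> (\<Sum>x\<in>F. b x) + \<rho> * norm g"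
    using xs by (simp add: L_def comp_def sum_list_distinct_conv_sum_set g_def)
  then have "\<epsilon> \<le> (real (card F) + 1) * \<delta>" using 1 by simp
  moreover have "(real (card F) + 1) * \<delta> = \<epsilon> / 2"
  proof -
    have "real (card F) + 1 \<noteq> 0" by linarith
    then show ?thesis unfolding \<delta>_def by (rule nonzero_mult_div_cancel_left[of _ "\<epsilon> / 2", folded times_divide_eq_right])
  qed
  ultimately show False using \<epsilon> by simp
qed


section \<open>Radii, balls in the second dual and interiors\<close>

lemma norm_canonical_embed_le: "norm (canonical_embed z) \<le> norm z"
proof (rule norm_blinfun_bound)
  show "norm (blinfun_apply (canonical_embed z) f) \<le> norm z * norm f" for f
    using norm_blinfun[of f z] by (simp add: canonical_embed_apply mult.commute)
qed simp

text \<open>Every number below the supremum satisfies \<open>ball_condition\<close>, an inequality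
  continuous in the radius, so it persists in the limit. The condition at \<open>r\<close> in turn
  makes \<open>r\<close> a member of the set, so a finite supremum is attained.\<close>

lemma loose_radius_ge_iff:
  fixes C :: "'a::real_normed_vector set"
  assumes "convex C" "C \<noteq> {}" and \<rho>: "\<rho> \<ge> 0" and r: "r \<ge> 0"
  shows "ereal r \<le> loose_radius C \<rho> \<longleftrightarrow> ball_condition C \<rho> r"
proof
  assume bc: "ball_condition C \<rho> r"
  show "ereal r \<le> loose_radius C \<rho>"
    unfolding loose_radius_def
    using ball_condition_imp_approximate_translates[OF assms(1-3) bc] r
    by (intro Sup_upper) blast
next
  assume lr: "ereal r \<le> loose_radius C \<rho>"
  \<comment> \<open>For \<open>r = 0\<close> the numbers \<open>s\<close> are negative. They still
    produce a member \<open>r1\<close>, because a nonnegative supremum in \<open>ereal\<close> comes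
    from a nonempty set.\<close>
  have bc_less: "ball_condition C \<rho> s" if s: "s < r" for s
  proof -
    have "ereal s < ereal r" using s by simp
    then have "ereal s < loose_radius C \<rho>" using lr by (rule less_le_trans)
    then obtain u where u: "u \<in> {ereal r |r. 0 \<le> r \<and> (\<forall>F. finite F \<and> F \<subseteq> cball 0 r \<longrightarrow>
        (\<forall>\<epsilon>>0. \<exists>y. \<exists>z \<in> cball 0 \<rho>. (\<forall>x\<in>F. norm (x - y x) < \<epsilon>) \<and> (+) z ` y ` F \<subseteq> C))}" "ereal s < u"
      unfolding loose_radius_def less_Sup_iff by (elim bexE)
    from u(1) obtain r1 where u1: "u = ereal r1" and r1: "r1 \<ge> 0" and H0: "\<forall>F. finite F \<and> F \<subseteq> cball 0 r1 \<longrightarrow>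
        (\<forall>\<epsilon>>0. \<exists>y. \<exists>z \<in> cball 0 \<rho>. (\<forall>x\<in>F. norm (x - y x) < \<epsilon>) \<and> (+) z ` y ` F \<subseteq> C)"
      by (elim CollectE exE conjE)
    have sr1: "s < r1" using u(2) u1 by simp
    have "ball_condition C \<rho> r1"
    proof (rule ball_condition_of_approximate_translates[OF r1])
      fix F :: "'a set" and \<epsilon> :: real
      assume F: "finite F" "F \<subseteq> cball 0 r1" and \<epsilon>: "\<epsilon> > 0"
      obtain y z where z: "z \<in> cball 0 \<rho>" and y: "\<forall>x\<in>F. norm (x - y x) < \<epsilon>" "(+) z ` y ` F \<subseteq> C"
        using H0 F \<epsilon> by meson
      have "blinfun_apply (canonical_embed z) f + blinfun_apply f x \<le> b + \<epsilon> * norm f"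
        if "x \<in> F" "\<forall>c\<in>C. blinfun_apply f c \<le> b" for x f b
      proof -
        have "f z + f (y x) \<le> b" using that y(2) by (auto simp flip: blinfun.add_right)
        moreover have "f (x - y x) \<le> norm f * norm (x - y x)"
          using norm_blinfun[of f "x - y x"] by simp
        moreover have "norm f * norm (x - y x) \<le> norm f * \<epsilon>"
          using y(1) that by (intro mult_left_mono) (auto intro: less_imp_le)
        ultimately show ?thesis by (simp add: canonical_embed_apply blinfun.diff_right mult.commute)
      qed
      moreover have "canonical_embed z \<in> cball 0 \<rho>"
        using z norm_canonical_embed_le[of z] by simp
      ultimately show "\<exists>z \<in> cball (0 :: 'a bidual) \<rho>. \<forall>x\<in>F. \<forall>f b.
          (\<forall>c\<in>C. blinfun_apply f c \<le> b) \<longrightarrow> blinfun_apply z f + blinfun_apply f x \<le> b + \<epsilon> * norm f"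
        by blast
    qed
    moreover have "s * (\<Sum>(f, b)\<leftarrow>L. norm f) \<le> r1 * (\<Sum>(f, b)\<leftarrow>L. norm f)" for L :: "('a dual \<times> real) list"
      using sr1 by (intro mult_right_mono) (auto intro!: sum_list_nonneg)
    ultimately show ?thesis unfolding ball_condition_def by (meson order_trans)
  qed
  show "ball_condition C \<rho> r"
    unfolding ball_condition_def
  proof (intro allI impI)
    fix L :: "('a dual \<times> real) list" assume L: "supports C L"
    have "((\<lambda>s. s * (\<Sum>(f, b)\<leftarrow>L. norm f)) \<longlongrightarrow> r * (\<Sum>(f, b)\<leftarrow>L. norm f)) (at_left r)"
      by (intro tendsto_intros)
    moreover have "\<forall>\<^sub>F s in at_left r. s * (\<Sum>(f, b)\<leftarrow>L. norm f)
        \<le> (\<Sum>(f, b)\<leftarrow>L. b) + \<rho> * norm (\<Sum>(f, b)\<leftarrow>L. f)"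
    proof -
      have "\<forall>\<^sub>F s in at_left r. s \<in> {r - 1<..<r}" by (intro eventually_at_left_real) simp
      then show ?thesis
        by (rule eventually_mono) (use bc_less L in \<open>simp add: ball_condition_def\<close>)
    qed
    ultimately show "r * (\<Sum>(f, b)\<leftarrow>L. norm f) \<le> (\<Sum>(f, b)\<leftarrow>L. b) + \<rho> * norm (\<Sum>(f, b)\<leftarrow>L. f)"
      by (intro tendsto_upperbound) auto
  qed
qed

lemma ball_condition_of_finite_translates:
  fixes C :: "'a::real_normed_vector set"
  assumes "convex C" "C \<noteq> {}" and r: "r \<ge> 0"
    and H: "\<And>F. finite F \<Longrightarrow> F \<subseteq> cball 0 r \<Longrightarrow>
      \<exists>z \<in> cball (0 :: 'a bidual) \<rho>. (+) z ` canonical_embed ` F \<subseteq> wstar_cl C"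
  shows "ball_condition C \<rho> r"
proof (rule ball_condition_of_approximate_translates[OF r])
  fix F :: "'a set" and \<epsilon> :: real
  assume F: "finite F" "F \<subseteq> cball 0 r" and \<epsilon>: "\<epsilon> > 0"
  obtain z :: "'a bidual" where z: "z \<in> cball 0 \<rho>" and zF: "(+) z ` canonical_embed ` F \<subseteq> wstar_cl C"
    using H[OF F] by blast
  have "blinfun_apply z f + blinfun_apply f x \<le> b + \<epsilon> * norm f"
    if "x \<in> F" "\<forall>c\<in>C. blinfun_apply f c \<le> b" for x f b
  proof -
    have "z + canonical_embed x \<in> wstar_cl C" using zF that by auto
    then have "blinfun_apply (z + canonical_embed x) f \<le> b"
      using that(2) mem_wstar_cl_iff[OF assms(1,2)] by blast
    moreover have "\<epsilon> * norm f \<ge> 0" using \<epsilon> by simp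
    ultimately show ?thesis by (simp add: blinfun.add_left canonical_embed_apply)
  qed
  then show "\<exists>z \<in> cball (0 :: 'a bidual) \<rho>. \<forall>x\<in>F. \<forall>f b.
      (\<forall>c\<in>C. blinfun_apply f c \<le> b) \<longrightarrow> blinfun_apply z f + blinfun_apply f x \<le> b + \<epsilon> * norm f"
    using z by blast
qed

text \<open>The implications run from \<open>?bc\<close> to \<open>?ball\<close> to
  \<open>?fin\<close> and back, so the passage from finite sets to a single \<open>z\<close> goes
  through the inequality on the dual.\<close>

lemma ball_condition_iff_finite_translates:
  fixes C :: "'a::real_normed_vector set"
  assumes "convex C" "C \<noteq> {}" "\<rho> \<ge> 0" "r \<ge> 0"
  shows "ball_condition C \<rho> r \<longleftrightarrow> (\<forall>F. finite F \<and> F \<subseteq> cball 0 r \<longrightarrow>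
      (\<exists>z \<in> cball (0 :: 'a bidual) \<rho>. (+) z ` canonical_embed ` F \<subseteq> wstar_cl C))" (is "?bc \<longleftrightarrow> ?fin")
    and "ball_condition C \<rho> r \<longleftrightarrow> (\<exists>z \<in> cball (0 :: 'a bidual) \<rho>. (+) z ` cball 0 r \<subseteq> wstar_cl C)" (is "_ \<longleftrightarrow> ?ball")
proof -
  have "?bc \<Longrightarrow> ?ball"
    using ball_condition_imp_ball_subset[OF assms(1-3)] by metis
  moreover have "?fin" if ball: "?ball"
  proof -
    obtain z :: "'a bidual" where z: "z \<in> cball 0 \<rho>" "(+) z ` cball 0 r \<subseteq> wstar_cl C"
      using ball by blast
    have "(+) z ` canonical_embed ` F \<subseteq> wstar_cl C" if "F \<subseteq> cball 0 r" for F
    proof -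
      have "canonical_embed ` F \<subseteq> cball 0 r"
      proof (rule image_subsetI)
        fix x assume "x \<in> F"
        then have "norm x \<le> r" using that by auto
        then show "canonical_embed x \<in> cball 0 r" using norm_canonical_embed_le[of x] by simp
      qed
      then show ?thesis using z(2) by blast
    qed
    then show ?thesis using z(1) by blast
  qed
  moreover have "?bc" if fin: "?fin"
    by (rule ball_condition_of_finite_translates[OF assms(1,2,4)], rule fin[rule_format], rule conjI)
  ultimately show "?bc \<longleftrightarrow> ?fin" "?bc \<longleftrightarrow> ?ball" by blast+
qed

lemma loose_radius_eq_inner_radius:
  fixes C :: "'a::real_normed_vector set"
  assumes "convex C" "C \<noteq> {}" "\<rho> \<ge> 0"
  shows "loose_radius C \<rho> = inner_radius (wstar_cl C) \<rho>"
proof (rule antisym)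
  show "loose_radius C \<rho> \<le> inner_radius (wstar_cl C) \<rho>"
    unfolding loose_radius_def
  proof (rule Sup_least)
    fix u assume u: "u \<in> {ereal r |r. 0 \<le> r \<and> (\<forall>F. finite F \<and> F \<subseteq> cball 0 r \<longrightarrow>
        (\<forall>\<epsilon>>0. \<exists>y. \<exists>z \<in> cball 0 \<rho>. (\<forall>x\<in>F. norm (x - y x) < \<epsilon>) \<and> (+) z ` y ` F \<subseteq> C))}"
    then have "u \<le> loose_radius C \<rho>" unfolding loose_radius_def by (rule Sup_upper)
    moreover from u obtain r where r: "u = ereal r" "r \<ge> 0" by (elim CollectE exE conjE)
    ultimately have "ball_condition C \<rho> r" using loose_radius_ge_iff[OF assms r(2)] by simp
    then obtain z :: "'a bidual" where "z \<in> cball 0 \<rho>" "(+) z ` cball 0 r \<subseteq> wstar_cl C"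
      using ball_condition_iff_finite_translates(2)[OF assms r(2)] by blast
    then show "u \<le> inner_radius (wstar_cl C) \<rho>"
      unfolding inner_radius_def using r by (intro Sup_upper) auto
  qed
next
  show "inner_radius (wstar_cl C) \<rho> \<le> loose_radius C \<rho>"
    unfolding inner_radius_def
  proof (rule Sup_least, clarify)
    fix r z assume "0 \<le> r" "z \<in> cball (0 :: 'a bidual) \<rho>" "cball z r \<subseteq> wstar_cl C"
    then have "ball_condition C \<rho> r"
      using ball_condition_iff_finite_translates(2)[OF assms \<open>0 \<le> r\<close>] by (auto intro!: bexI[of _ z])
    then show "ereal r \<le> loose_radius C \<rho>" using loose_radius_ge_iff[OF assms \<open>0 \<le> r\<close>] by blast
  qed
qed

text \<open>The ball may be centred anywhere, hence the quantifier over \<open>\<rho>\<close>: the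
  norm of the centre serves.\<close>

lemma interior_wstar_cl_nonempty_iff:
  fixes C :: "'a::real_normed_vector set"
  assumes "convex C" "C \<noteq> {}"
  shows "interior (wstar_cl C) \<noteq> {} \<longleftrightarrow> (\<exists>\<rho>\<ge>0. \<exists>r>0. ball_condition C \<rho> r)"
proof
  assume "interior (wstar_cl C) \<noteq> {}"
  then obtain z e where z: "e > 0" "cball z e \<subseteq> wstar_cl C"
    by (metis ex_in_conv mem_interior_cball)
  then have "ball_condition C (norm z) e"
    using ball_condition_iff_finite_translates(2)[OF assms, of "norm z" e] by (auto intro!: bexI[of _ z])
  then show "\<exists>\<rho>\<ge>0. \<exists>r>0. ball_condition C \<rho> r" using z(1) norm_ge_zero by blast
next
  assume "\<exists>\<rho>\<ge>0. \<exists>r>0. ball_condition C \<rho> r"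
  then obtain \<rho> r where "\<rho> \<ge> 0" "r > 0" "ball_condition C \<rho> r" by blast
  then obtain z :: "'a bidual" where z: "(+) z ` cball 0 r \<subseteq> wstar_cl C"
    using ball_condition_iff_finite_translates(2)[OF assms, of \<rho> r] by auto
  then have "cball z r \<subseteq> wstar_cl C" by simp
  then have "z \<in> interior (wstar_cl C)" using \<open>r > 0\<close> mem_interior_cball by blast
  then show "interior (wstar_cl C) \<noteq> {}" by blast
qed

section \<open>Translating compact sets into \<open>C\<close>\<close>

text \<open>Translate a finite \<open>\<epsilon> / 2\<close>-net approximately; the errors of all
  points of \<open>K\<close> then lie in \<open>K\<close> minus a finite set. Their compactness
  allows the construction to be repeated on the errors.\<close>

lemma ball_condition_imp_compact_errors:
  fixes C :: "'a::real_normed_vector set"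
  assumes "convex C" "C \<noteq> {}" "\<rho> \<ge> 0" and bc: "ball_condition C \<rho> r"
    and K: "compact K" "K \<subseteq> cball 0 r" and \<epsilon>: "\<epsilon> > 0"
  shows "\<exists>z E. norm z \<le> \<rho> \<and> compact E \<and> E \<subseteq> cball 0 \<epsilon> \<and> (\<forall>x\<in>K. \<exists>e\<in>E. z + x - e \<in> C)"
proof -
  obtain F where F: "F \<subseteq> K" "finite F" "K \<subseteq> (\<Union>x\<in>F. ball x (\<epsilon> / 2))"
    using \<epsilon> by (rule_tac compactE_image[OF K(1), of K "\<lambda>x. ball x (\<epsilon> / 2)"]) auto
  have "F \<subseteq> cball 0 r" using F(1) K(2) by blast
  then obtain y z where z: "norm z \<le> \<rho>" and y: "\<forall>x\<in>F. norm (x - y x) < \<epsilon> / 2" "(+) z ` y ` F \<subseteq> C"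
    using ball_condition_imp_approximate_translates[OF assms(1-4) F(2), of "\<epsilon> / 2"] \<epsilon>
    by auto
  define E where "E = {x - w | x w. x \<in> K \<and> w \<in> y ` F} \<inter> cball 0 \<epsilon>"
  have "compact E" unfolding E_def
    by (intro compact_Int_closed compact_differences K(1) finite_imp_compact finite_imageI F(2) closed_cball)
  moreover have "\<exists>e\<in>E. z + x - e \<in> C" if xK: "x \<in> K" for x
  proof -
    obtain x' where "x' \<in> F" "x \<in> ball x' (\<epsilon> / 2)" using F(3) xK by blast
    then have x': "x' \<in> F" "norm (x - x') < \<epsilon> / 2" by (auto simp: dist_norm norm_minus_commute)
    have "norm (x - y x') \<le> norm (x - x') + norm (x' - y x')"
      using norm_triangle_ineq[of "x - x'" "x' - y x'"] by simp
    then have "x - y x' \<in> E" unfolding E_def using x' y(1) xK by force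
    moreover have "z + x - (x - y x') \<in> C" using y(2) x'(1) by auto
    ultimately show ?thesis by blast
  qed
  moreover have "E \<subseteq> cball 0 \<epsilon>" by (simp add: E_def)
  ultimately show ?thesis using z by blast
qed

text \<open>
  With \<open>x\<^sub>0 = 2 x\<close> and \<open>c\<^sub>n = z\<^sub>n + x\<^sub>n - x\<^sub>n\<^sub>+\<^sub>1 / 2 \<in> C\<close>, the convex series \<open>\<Sum>c\<^sub>n / 2\<^sup>n\<^sup>+\<^sup>1\<close> telescopes
  to \<open>x + \<Sum>z\<^sub>n / 2\<^sup>n\<^sup>+\<^sup>1\<close>.
\<close>

lemma ball_condition_imp_compact_translate:
  fixes C :: "'a::banach set"
  assumes "convex C" "C \<noteq> {}" "closed C" "\<rho> \<ge> 0" and bc: "ball_condition C \<rho> r" and r: "r > 0"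
    and K: "compact K" "K \<subseteq> cball 0 (r / 2)"
  shows "\<exists>z. \<forall>x\<in>K. z + x \<in> C"
proof -
  \<comment> \<open>Errors of size at most \<open>r / 2\<close>, doubled, fill at most the ball of
    radius \<open>r\<close> again, so the step iterates at constant scale.\<close>
  have step: "\<exists>z L'. norm z \<le> \<rho> \<and> compact L' \<and> L' \<subseteq> cball 0 r \<and> (\<forall>x\<in>L. \<exists>x'\<in>L'. z + x - x' /\<^sub>R 2 \<in> C)"
    if L: "compact L" "L \<subseteq> cball 0 r" for L :: "'a set"
  proof -
    obtain z E where z: "norm z \<le> \<rho>" "compact E" "E \<subseteq> cball 0 (r / 2)" "\<forall>x\<in>L. \<exists>e\<in>E. z + x - e \<in> C"
      using ball_condition_imp_compact_errors[OF assms(1,2,4) bc L, of "r / 2"] r by auto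
    have "\<forall>x\<in>L. \<exists>x'\<in>(\<lambda>e. 2 *\<^sub>R e) ` E. z + x - x' /\<^sub>R 2 \<in> C" using z(4) by simp
    moreover have "compact ((\<lambda>e. 2 *\<^sub>R e) ` E)" using z(2) by (rule compact_scaling)
    moreover have "(\<lambda>e. 2 *\<^sub>R e) ` E \<subseteq> cball 0 r" using z(3) by auto
    ultimately show ?thesis using z(1) by blast
  qed
  have "\<exists>Ks. (\<forall>n. ((compact (Ks n) \<and> Ks n \<subseteq> cball 0 r) \<and> (n = 0 \<longrightarrow> Ks n = (\<lambda>x. 2 *\<^sub>R x) ` K)) \<and>
      (\<exists>z. norm z \<le> \<rho> \<and> (\<forall>x\<in>Ks n. \<exists>x'\<in>Ks (Suc n). z + x - x' /\<^sub>R 2 \<in> C)))"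
  proof (rule dependent_nat_choice)
    have "compact ((\<lambda>x. 2 *\<^sub>R x) ` K)" using K(1) by (rule compact_scaling)
    moreover have "(\<lambda>x. 2 *\<^sub>R x) ` K \<subseteq> cball 0 r" using K(2) by auto
    ultimately show "\<exists>L. (compact L \<and> L \<subseteq> cball 0 r) \<and> (0 = 0 \<longrightarrow> L = (\<lambda>x. 2 *\<^sub>R x) ` K)" by blast
  next
    fix L :: "'a set" and n :: nat
    assume "(compact L \<and> L \<subseteq> cball 0 r) \<and> (n = 0 \<longrightarrow> L = (\<lambda>x. 2 *\<^sub>R x) ` K)"
    then show "\<exists>L'. ((compact L' \<and> L' \<subseteq> cball 0 r) \<and> (Suc n = 0 \<longrightarrow> L' = (\<lambda>x. 2 *\<^sub>R x) ` K)) \<and>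
        (\<exists>z. norm z \<le> \<rho> \<and> (\<forall>x\<in>L. \<exists>x'\<in>L'. z + x - x' /\<^sub>R 2 \<in> C))"
      using step[of L] by auto
  qed
  then obtain Ks where Ks0: "\<forall>n. ((compact (Ks n) \<and> Ks n \<subseteq> cball 0 r) \<and> (n = 0 \<longrightarrow> Ks n = (\<lambda>x. 2 *\<^sub>R x) ` K)) \<and>
      (\<exists>z. norm z \<le> \<rho> \<and> (\<forall>x\<in>Ks n. \<exists>x'\<in>Ks (Suc n). z + x - x' /\<^sub>R 2 \<in> C))"
    by (elim exE)
  have Ks: "Ks n \<subseteq> cball 0 r" "Ks 0 = (\<lambda>x. 2 *\<^sub>R x) ` K" for n
    using Ks0 by simp_all
  have "\<forall>n. \<exists>z. norm z \<le> \<rho> \<and> (\<forall>x\<in>Ks n. \<exists>x'\<in>Ks (Suc n). z + x - x' /\<^sub>R 2 \<in> C)"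
    using Ks0 by (intro allI) (elim allE conjE)
  from choice[OF this]
  obtain z where z: "\<And>n. norm (z n) \<le> \<rho>"
      "\<And>n x. x \<in> Ks n \<Longrightarrow> \<exists>x'\<in>Ks (Suc n). z n + x - x' /\<^sub>R 2 \<in> C" by metis
  define h where "h n = (1/2::real) ^ n" for n
  have sumz: "summable (\<lambda>n. h (Suc n) *\<^sub>R z n)"
  proof (rule summable_comparison_test')
    show "summable (\<lambda>n. h n * \<rho>)" unfolding h_def by (intro summable_mult2 summable_geometric) simp
    show "norm (h (Suc n) *\<^sub>R z n) \<le> h n * \<rho>" for n
      using z(1)[of n] assms(4) by (auto simp: h_def intro!: mult_mono)
  qed
  \<comment> \<open>The sets \<open>Ks n\<close> and the vectors \<open>z n\<close> are fixed before
    \<open>x\<close>, so the same sum translates all of \<open>K\<close>.\<close>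
  have "suminf (\<lambda>n. h (Suc n) *\<^sub>R z n) + x \<in> C" if x: "x \<in> K" for x
  proof -
    have "\<exists>xs. \<forall>n. (xs n \<in> Ks n \<and> (n = 0 \<longrightarrow> xs n = 2 *\<^sub>R x)) \<and> (z n + xs n - xs (Suc n) /\<^sub>R 2 \<in> C)"
    proof (rule dependent_nat_choice[where P = "\<lambda>n u. u \<in> Ks n \<and> (n = 0 \<longrightarrow> u = 2 *\<^sub>R x)"
          and Q = "\<lambda>n u v. z n + u - v /\<^sub>R 2 \<in> C"])
      show "\<exists>u. u \<in> Ks 0 \<and> (0 = 0 \<longrightarrow> u = 2 *\<^sub>R x)" using Ks(2) x by blast
    qed (use z(2) in auto)
    then obtain xs where xs: "\<And>n. xs n \<in> Ks n" "xs 0 = 2 *\<^sub>R x"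
        "\<And>n. z n + xs n - xs (Suc n) /\<^sub>R 2 \<in> C" by blast
    define c where "c n = z n + xs n - xs (Suc n) /\<^sub>R 2" for n
    \<comment> \<open>The weights used up to \<open>N\<close> leave exactly \<open>h N\<close>;
      giving it to a point \<open>d\<close> of \<open>C\<close> makes every partial sum a convex
      combination.\<close>
    have inC: "(\<Sum>n<N. h (Suc n) *\<^sub>R c n) + h N *\<^sub>R d \<in> C" if "d \<in> C" for N d
      using that
    proof (induction N arbitrary: d)
      case (Suc N)
      have "(1/2) *\<^sub>R c N + (1/2) *\<^sub>R d \<in> C"
        using xs(3)[of N] Suc.prems by (intro convexD[OF assms(1)]) (auto simp: c_def)
      from Suc.IH[OF this] show ?case by (simp add: h_def scaleR_add_right algebra_simps)
    qed (simp add: h_def)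
    have telescope: "(\<Sum>n<N. h (Suc n) *\<^sub>R c n) = (\<Sum>n<N. h (Suc n) *\<^sub>R z n) + x - h (Suc N) *\<^sub>R xs N" for N
      by (induction N) (auto simp: h_def c_def xs(2) algebra_simps)
    obtain d where d: "d \<in> C" using assms(2) by auto
    have h0: "h \<longlonglongrightarrow> 0" unfolding h_def by (rule LIMSEQ_power_zero) simp
    then have "(\<lambda>N. h (Suc N)) \<longlonglongrightarrow> 0" by (rule LIMSEQ_Suc)
    moreover have "norm (xs n) \<le> r" for n using xs(1)[of n] Ks(1)[of n] by auto
    ultimately have "(\<lambda>N. h (Suc N) *\<^sub>R xs N) \<longlonglongrightarrow> 0"
      by (intro lim_null_scaleR_bounded[where B = r]) auto
    moreover have "(\<lambda>N. \<Sum>n<N. h (Suc n) *\<^sub>R z n) \<longlonglongrightarrow> suminf (\<lambda>n. h (Suc n) *\<^sub>R z n)"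
      using sumz by (rule summable_LIMSEQ)
    ultimately have "(\<lambda>N. (\<Sum>n<N. h (Suc n) *\<^sub>R z n) + x - h (Suc N) *\<^sub>R xs N + h N *\<^sub>R d)
        \<longlonglongrightarrow> suminf (\<lambda>n. h (Suc n) *\<^sub>R z n) + x - 0 + 0 *\<^sub>R d"
      using h0 by (intro tendsto_intros)
    moreover have "(\<Sum>n<N. h (Suc n) *\<^sub>R z n) + x - h (Suc N) *\<^sub>R xs N + h N *\<^sub>R d \<in> C" for N
      using inC[OF d] unfolding telescope .
    ultimately show ?thesis using closed_sequentially[OF assms(3)] by (smt (verit) diff_zero scaleR_zero_left add.right_neutral)
  qed
  then show ?thesis by blast
qed


section \<open>Positive measure of a translate\<close>

text \<open>At each radius \<open>1 / Suc n\<close>, finitely many balls around the dense points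
  carry almost all the mass. The intersection of these unions is closed and totally bounded.\<close>

lemma prob_space_compact_approx:
  fixes \<mu> :: "'a::{metric_space, complete_space} measure" and D :: "'a set"
  assumes "prob_space \<mu>" and sets: "sets \<mu> = sets borel"
    and D: "countable D" "\<And>x e. e > 0 \<Longrightarrow> \<exists>d\<in>D. dist d x < e" and e: "e > 0"
  shows "\<exists>K. compact K \<and> measure \<mu> K > 1 - e"
proof -
  interpret prob_space \<mu> by fact
  have space: "space \<mu> = UNIV" using sets_eq_imp_space_eq[OF sets] by simp
  have meas: "A \<in> sets \<mu>" if "closed A" for A using that sets by simp
  have "D \<noteq> {}" using D(2)[of 1] by (metis empty_iff zero_less_one)
  then have ran: "range (from_nat_into D) = D" using D(1) by (rule range_from_nat_into)
  define B where "B n N = (\<Union>i\<le>N. cball (from_nat_into D i) (1 / Suc n))" for n N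
  have closedB: "closed (B n N)" for n N unfolding B_def by (intro closed_UN) auto
  \<comment> \<open>These losses add up to \<open>e / 2\<close>, which leaves room for the strict
    inequality.\<close>
  have "\<exists>N. measure \<mu> (B n N) > 1 - e * (1/2) ^ (n + 2)" for n
  proof -
    have "(\<lambda>N. measure \<mu> (B n N)) \<longlonglongrightarrow> measure \<mu> (\<Union>N. B n N)"
    proof (rule finite_Lim_measure_incseq)
      show "range (B n) \<subseteq> sets \<mu>" using closedB meas by blast
      show "incseq (B n)" unfolding B_def by (intro incseq_SucI UN_mono) auto
    qed
    moreover have "(\<Union>N. B n N) = space \<mu>"
    proof -
      have "x \<in> (\<Union>N. B n N)" for x
      proof -
        obtain d where d: "d \<in> D" "dist d x < 1 / Suc n" using D(2)[of "1 / Suc n"] by auto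
        then obtain i where "d = from_nat_into D i" using ran by blast
        then have "x \<in> B n i" using d(2) unfolding B_def by (auto intro!: bexI[of _ i])
        then show ?thesis by blast
      qed
      then show ?thesis using space by auto
    qed
    ultimately have "(\<lambda>N. measure \<mu> (B n N)) \<longlonglongrightarrow> 1" by (simp add: prob_space)
    then have "\<forall>\<^sub>F N in sequentially. measure \<mu> (B n N) > 1 - e * (1/2) ^ (n + 2)"
      using e by (intro order_tendstoD) auto
    then show ?thesis by (auto simp: eventually_sequentially)
  qed
  then obtain N where N: "\<And>n. measure \<mu> (B n (N n)) > 1 - e * (1/2) ^ (n + 2)" by metis
  define K where "K = (\<Inter>n. B n (N n))"
  have closedK: "closed K" unfolding K_def using closedB by blast
  have "compact K" unfolding compact_eq_totally_bounded
  proof (intro conjI allI impI)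
    show "complete K" using closedK by (simp add: complete_eq_closed)
  next
    fix \<epsilon> :: real assume "\<epsilon> > 0"
    then obtain n where n: "1 / Suc n < \<epsilon>" using nat_approx_posE by blast
    have "K \<subseteq> (\<Union>x\<in>from_nat_into D ` {..N n}. ball x \<epsilon>)"
    proof
      fix x assume "x \<in> K"
      then obtain i where "i \<le> N n" "x \<in> cball (from_nat_into D i) (1 / Suc n)"
        unfolding K_def B_def by blast
      then show "x \<in> (\<Union>x\<in>from_nat_into D ` {..N n}. ball x \<epsilon>)" using n by force
    qed
    then show "\<exists>k. finite k \<and> K \<subseteq> (\<Union>x\<in>k. ball x \<epsilon>)" by blast
  qed
  moreover have "measure \<mu> K > 1 - e"
  proof -
    have le: "measure \<mu> (space \<mu> - B n (N n)) \<le> e * (1/2) ^ (n + 2)" for n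
      using N[of n] closedB meas by (simp add: prob_compl)
    have sums: "(\<lambda>n. e * (1/2) ^ (n + 2)) sums (e / 2)"
      using sums_mult[OF geometric_sums[of "1/2 :: real"], of "e / 4"] by (simp add: power_add)
    have summ: "summable (\<lambda>n. measure \<mu> (space \<mu> - B n (N n)))"
      by (rule summable_comparison_test'[OF sums_summable[OF sums]]) (use le in simp)
    have "measure \<mu> (\<Union>n. space \<mu> - B n (N n)) \<le> suminf (\<lambda>n. measure \<mu> (space \<mu> - B n (N n)))"
      using closedB meas by (intro finite_measure_subadditive_countably summ) auto
    also have "\<dots> \<le> e / 2"
      using suminf_le[OF le summ sums_summable[OF sums]] sums_unique[OF sums] by simp
    finally have "measure \<mu> (space \<mu> - K) < e" using e by (simp add: K_def)
    then show ?thesis using prob_compl[OF meas[OF closedK]] by simp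
  qed
  ultimately show ?thesis by blast
qed

text \<open>By separability and tightness, a Borel probability measure charges a compact part of
  some ball of radius \<open>r / 2\<close>. Recentred, this part has a translate inside
  \<open>C\<close>, so some translate of \<open>C\<close> has positive measure.\<close>

lemma ball_condition_imp_not_haar_null:
  fixes C :: "'a::banach set"
  assumes C: "convex C" "C \<noteq> {}" "closed C" and "\<rho> \<ge> 0" "r > 0" "ball_condition C \<rho> r"
    and sep: "separable_space (euclidean :: 'a topology)"
  shows "\<not> haar_null C"
proof
  assume "haar_null C"
  then obtain \<mu> :: "'a measure" where \<mu>: "prob_space \<mu>" "sets \<mu> = sets borel"
    and null: "\<And>x. emeasure \<mu> ((+) x ` C) = 0" by (auto simp: haar_null_def)
  interpret prob_space \<mu> by fact
  have space: "space \<mu> = UNIV" using sets_eq_imp_space_eq[OF \<mu>(2)] by simp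
  have meas: "A \<in> sets \<mu>" if "closed A" for A using that \<mu>(2) by simp
  obtain D :: "'a set" where D: "countable D" "closure D = UNIV"
    using sep by (auto simp: separable_space_def)
  have dense: "\<exists>d\<in>D. dist d x < e" if "e > 0" for x e
    using D(2) that closure_approachable[of x D] by auto
  have "\<exists>d. measure \<mu> (cball d (r / 2)) > 0"
  proof (rule ccontr)
    assume "\<not> ?thesis"
    then have "cball d (r / 2) \<in> null_sets \<mu>" for d
      using meas[of "cball d (r / 2)"] by (simp add: null_sets_def emeasure_eq_measure not_less measure_le_0_iff)
    then have "(\<Union>d\<in>D. cball d (r / 2)) \<in> null_sets \<mu>"
      using D(1) by (intro null_sets_UN') auto
    then have "emeasure \<mu> (\<Union>d\<in>D. cball d (r / 2)) = 0" by (rule null_setsD1)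
    moreover have "(\<Union>d\<in>D. cball d (r / 2)) = space \<mu>"
      using dense[of "r / 2"] \<open>r > 0\<close> space by (force intro: less_imp_le)
    ultimately show False using emeasure_space_1 by simp
  qed
  then obtain d where d: "measure \<mu> (cball d (r / 2)) > 0" by blast
  \<comment> \<open>With the mass of the ball as tolerance, \<open>K\<close> and the ball have total
    mass above \<open>1\<close> and must overlap in positive measure.\<close>
  obtain K where K: "compact K" "measure \<mu> K > 1 - measure \<mu> (cball d (r / 2))"
    using prob_space_compact_approx[OF \<mu> D(1) dense d] by blast
  define L where "L = K \<inter> cball d (r / 2)"
  have "measure \<mu> (K \<union> cball d (r / 2)) = measure \<mu> K + measure \<mu> (cball d (r / 2)) - measure \<mu> L"
    unfolding L_def using meas[OF compact_imp_closed[OF K(1)]] meas[of "cball d (r / 2)"]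
    by (intro measure_Un3) (auto simp: fmeasurable_def emeasure_eq_measure)
  then have L: "measure \<mu> L > 0"
    using K(2) prob_le_1[of "K \<union> cball d (r / 2)"] by linarith
  have "compact ((\<lambda>x. x - d) ` L)" unfolding L_def
    using K(1) by (intro compact_continuous_image continuous_intros) (auto intro: compact_Int_closed)
  moreover have "(\<lambda>x. x - d) ` L \<subseteq> cball 0 (r / 2)"
    by (auto simp: L_def dist_norm norm_minus_commute)
  ultimately obtain z where z: "\<forall>x\<in>(\<lambda>x. x - d) ` L. z + x \<in> C"
    using ball_condition_imp_compact_translate[OF C assms(4,6,5)] by blast
  have "L \<subseteq> (+) (d - z) ` C"
  proof
    fix x assume "x \<in> L"
    then have "z + (x - d) \<in> C" using z by blast
    then show "x \<in> (+) (d - z) ` C" by (intro image_eqI[of _ _ "z + (x - d)"]) auto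
  qed
  then have "emeasure \<mu> L \<le> emeasure \<mu> ((+) (d - z) ` C)"
    using C(3) by (intro emeasure_mono meas closed_translation)
  then show False using L null by (simp add: emeasure_eq_measure)
qed


section \<open>A test measure for Haar null sets\<close>

lemma pmf_of_weights:
  fixes w :: "nat \<Rightarrow> real"
  assumes "\<And>i. w i \<ge> 0" "(\<Sum>i<n. w i) = 1"
  obtains q where "\<And>A. measure_pmf.prob q A = (\<Sum>i\<in>{..<n} \<inter> A. w i)"
proof -
  define f where "f i = (if i < n then w i else 0)" for i
  have f0: "f i \<ge> 0" for i using assms(1) by (simp add: f_def)
  have "(\<integral>\<^sup>+i. ennreal (f i) \<partial>count_space UNIV) = (\<Sum>i<n. ennreal (f i))"
    by (intro nn_integral_count_space') (auto simp: f_def)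
  also have "\<dots> = ennreal (\<Sum>i<n. f i)" using f0 by (intro sum_ennreal) auto
  also have "\<dots> = 1" using assms(2) by (simp add: f_def)
  finally have int: "(\<integral>\<^sup>+i. ennreal (f i) \<partial>count_space UNIV) = 1" .
  have pmf: "pmf (embed_pmf f) i = f i" for i using f0 int by (rule pmf_embed_pmf)
  have set: "set_pmf (embed_pmf f) \<subseteq> {..<n}" by (auto simp: set_pmf_eq pmf f_def split: if_splits)
  have "measure_pmf.prob (embed_pmf f) A = (\<Sum>i\<in>{..<n} \<inter> A. w i)" for A
  proof -
    have "measure_pmf.prob (embed_pmf f) A = measure_pmf.prob (embed_pmf f) ({..<n} \<inter> A)"
      using set measure_Int_set_pmf[of "embed_pmf f" A] measure_Int_set_pmf[of "embed_pmf f" "{..<n} \<inter> A"]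
      by (metis Int_absorb1 Int_assoc Int_commute)
    also have "\<dots> = (\<Sum>i\<in>{..<n} \<inter> A. f i)"
      by (subst measure_measure_pmf_finite) (auto simp: pmf)
    also have "\<dots> = (\<Sum>i\<in>{..<n} \<inter> A. w i)" by (intro sum.cong) (auto simp: f_def)
    finally show ?thesis .
  qed
  then show ?thesis by (rule that)
qed

text \<open>
  Functionals violating the ball condition bound the total slack \<open>\<Sum>h i y\<close> of the points \<open>y\<close> of the
  neighbourhood \<open>D\<close> of \<open>C\<close>, so \<open>D\<close> is thin for the seminorm \<open>p\<close>. Let \<open>u i\<close> almost norm \<open>f i\<close>.
  If some \<open>p (u k)\<close> is large, \<open>D\<close> cannot contain both \<open>x + s u\<^sub>k\<close> and \<open>x - s u\<^sub>k\<close>.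
  If all \<open>p (u i)\<close> are small and \<open>x + s u\<^sub>i\<close> lies in \<open>D\<close>, its slack for \<open>f j\<close> is about \<open>s \<parallel>f j\<parallel> / 2\<close> whenever
  \<open>x + s u\<^sub>j\<close> lies in \<open>D\<close> too, so these \<open>j\<close> have at most half of the total weight.
\<close>

lemma not_ball_condition_imp_weights:
  fixes C :: "'a::real_normed_vector set"
  assumes "C \<noteq> {}" and s: "s > 0" and R: "R \<ge> 0" and nbc: "\<not> ball_condition C (R + s) (s / 16)"
  shows "\<exists>n g w. (\<forall>i. norm (g i) \<le> s) \<and> (\<forall>i. w i \<ge> (0::real)) \<and> (\<Sum>i<n. w i) = 1 \<and>
    (\<forall>x. norm x \<le> R \<longrightarrow> (\<Sum>i\<in>{..<n::nat} \<inter> {i. \<exists>c\<in>C. norm (x + g i - c) \<le> s / 16}. w i) \<le> 1 / 2)"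
proof -
  define e where "e = s / 16"
  \<comment> \<open>All points \<open>x + g i\<close> with \<open>norm x \<le> R\<close> and
    \<open>norm (g i) \<le> s\<close> have norm at most \<open>\<rho>\<close>, where
    \<open>hsum\<close> applies.\<close>
  define \<rho> where "\<rho> = R + s"
  obtain L where L: "supports C L"
    "e * (\<Sum>(f, b)\<leftarrow>L. norm f) > (\<Sum>(f, b)\<leftarrow>L. b) + \<rho> * norm (\<Sum>(f, b)\<leftarrow>L. f)"
    using nbc unfolding ball_condition_def e_def \<rho>_def by (auto simp: not_le)
  define n where "n = length L"
  define f where "f i = fst (L ! i)" for i
  define b where "b i = snd (L ! i)" for i
  define S where "S = (\<Sum>i<n. norm (f i))"
  define D where "D = {y. \<exists>c\<in>C. norm (y - c) \<le> e}"
  have fb: "f i c \<le> b i" if "i < n" "c \<in> C" for i c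
  proof -
    have "L ! i \<in> set L" using that(1) by (simp add: n_def)
    then show ?thesis using L(1) that(2) by (auto simp: supports_def f_def b_def case_prod_unfold)
  qed
  have "(\<Sum>(f, b)\<leftarrow>L. norm f) = S" "(\<Sum>(f, b)\<leftarrow>L. b) = (\<Sum>i<n. b i)" "(\<Sum>(f, b)\<leftarrow>L. f) = (\<Sum>i<n. f i)"
    by (simp_all add: sum_list_sum_nth S_def n_def f_def b_def case_prod_unfold atLeast0LessThan)
  then have viol: "(\<Sum>i<n. b i) + \<rho> * norm (\<Sum>i<n. f i) < e * S" using L(2) by simp
  obtain c0 where c0: "c0 \<in> C" using assms(1) by blast
  have S0: "S \<ge> 0" by (simp add: S_def sum_nonneg)
  have Spos: "S > 0"
  proof (rule ccontr)
    assume "\<not> S > 0"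
    then have "S = 0" using S0 by simp
    then have z: "f i = 0" if "i < n" for i using that by (simp add: S_def sum_nonneg_eq_0_iff)
    then have "(\<Sum>i<n. b i) \<ge> 0" using fb[OF _ c0] by (intro sum_nonneg) fastforce
    then show False using viol \<open>S = 0\<close> z by simp
  qed
  have e: "e > 0" using s by (simp add: e_def)
  \<comment> \<open>The term \<open>e * norm (f i)\<close> keeps the slack nonnegative on the
    neighbourhood \<open>D\<close>. Its total \<open>e * S\<close>, added to the
    \<open>e * S\<close> from the violated inequality, gives the \<open>2 * e * S\<close> of
    \<open>hsum\<close>.\<close>
  define h where "h i y = b i + e * norm (f i) - f i y" for i y
  have h0: "h i y \<ge> 0" if iy: "i < n" "y \<in> D" for i y
  proof -
    obtain c where c: "c \<in> C" "norm (y - c) \<le> e" using iy by (auto simp: D_def)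
    have "f i (y - c) \<le> norm (f i) * norm (y - c)" using norm_blinfun[of "f i" "y - c"] by simp
    also have "\<dots> \<le> norm (f i) * e" using c by (intro mult_left_mono) auto
    finally show ?thesis using fb[OF iy(1) c(1)] by (simp add: h_def blinfun.diff_right mult.commute)
  qed
  have hsum: "(\<Sum>i<n. h i y) \<le> 2 * e * S" if "norm y \<le> \<rho>" for y
  proof -
    have "(\<Sum>i<n. h i y) = (\<Sum>i<n. b i) + e * S - (\<Sum>i<n. f i) y"
      by (simp add: h_def S_def sum.distrib sum_subtractf sum_distrib_left blinfun.sum_left)
    moreover have "- ((\<Sum>i<n. f i) y) \<le> norm (\<Sum>i<n. f i) * norm y"
      using norm_blinfun[of "\<Sum>i<n. f i" y] by simp
    moreover have "norm (\<Sum>i<n. f i) * norm y \<le> norm (\<Sum>i<n. f i) * \<rho>"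
      using that by (intro mult_left_mono) auto
    ultimately show ?thesis using viol by (simp add: mult.commute)
  qed
  have "\<exists>u. norm u \<le> 1 \<and> f i u \<ge> norm (f i) / 2" for i
  proof (cases "f i = 0")
    case True
    then show ?thesis by (intro exI[of _ 0]) simp
  next
    case False
    then obtain u where "norm u \<le> 1" "f i u \<ge> 1 * norm (f i) - norm (f i) / 2"
      using almost_norming_vector[of 1 "norm (f i) / 2" "f i"] by auto
    then show ?thesis by auto
  qed
  then obtain u where u: "\<And>i. norm (u i) \<le> 1" "\<And>i. f i (u i) \<ge> norm (f i) / 2" by metis
  define p where "p v = (\<Sum>i<n. \<bar>f i v\<bar>)" for v
  show ?thesis
  proof (cases "\<exists>k. p (u k) > S / 8")
    case True
    then obtain k where k: "p (u k) > S / 8" by blast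
    define g where "g i = (if i = (0::nat) then s *\<^sub>R u k else - (s *\<^sub>R u k))" for i
    have g: "norm (g i) \<le> s" for i using s u(1)[of k] by (simp add: g_def)
    have notboth: "\<not> (x + g 0 \<in> D \<and> x + g 1 \<in> D)" if x: "norm x \<le> R" for x
    proof
      assume D: "x + g 0 \<in> D \<and> x + g 1 \<in> D"
      have small: "norm (x + g i) \<le> \<rho>" for i
        using norm_triangle_ineq[of x "g i"] g[of i] x by (simp add: \<rho>_def)
      \<comment> \<open>Both slacks are nonnegative, so their difference is at most their sum; since
        \<open>e = s / 16\<close>, the bound is \<open>p (u k) \<le> S / 8\<close>.\<close>
      have "2 * s * p (u k) = (\<Sum>i<n. \<bar>h i (x + g 1) - h i (x + g 0)\<bar>)"
        unfolding p_def sum_distrib_left using s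
        by (intro sum.cong) (auto simp: h_def g_def blinfun.add_right blinfun.diff_right blinfun.minus_right
            blinfun.scaleR_right abs_mult)
      also have "\<dots> \<le> (\<Sum>i<n. h i (x + g 1) + h i (x + g 0))"
        using h0 D by (intro sum_mono) (auto simp: abs_le_iff add_nonneg_nonneg)
      also have "\<dots> \<le> 4 * e * S" using hsum[OF small[of 0]] hsum[OF small[of 1]] by (simp add: sum.distrib)
      finally have "2 * s * p (u k) \<le> 2 * s * (S / 8)" by (simp add: e_def mult.commute)
      then show False using k s by simp
    qed
    have "(\<Sum>i\<in>{..<2} \<inter> {i. x + g i \<in> D}. 1 / 2 :: real) \<le> 1 / 2" if x: "norm x \<le> R" for x
    proof -
      have "{..<2} \<inter> {i. x + g i \<in> D} \<subseteq> {0} \<or> {..<2} \<inter> {i. x + g i \<in> D} \<subseteq> {1}"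
        using notboth[OF x] by (auto simp: less_2_cases_iff)
      then have "card ({..<2} \<inter> {i. x + g i \<in> D}) \<le> 1"
        by (metis card_mono finite.emptyI finite.insertI is_singletonI is_singleton_altdef)
      then show ?thesis by simp
    qed
    then show ?thesis using g
      by (intro exI[of _ 2] exI[of _ g] exI[of _ "\<lambda>_. 1 / 2"]) (auto simp: D_def e_def)
  next
    case False
    define g where "g i = s *\<^sub>R u i" for i
    have g: "norm (g i) \<le> s" for i using s u(1)[of i] by (simp add: g_def)
    define w where "w i = norm (f i) / S" for i
    have "(\<Sum>i<n. w i) = 1" using Spos by (simp add: w_def S_def flip: sum_divide_distrib)
    moreover have "(\<Sum>i\<in>{..<n} \<inter> {i. x + g i \<in> D}. w i) \<le> 1 / 2" if x: "norm x \<le> R" for x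
    proof (cases "{..<n} \<inter> {i. x + g i \<in> D} = {}")
      case True then show ?thesis by simp
    next
      case ne: False
      define J where "J = {..<n} \<inter> {i. x + g i \<in> D}"
      then obtain i where i: "i \<in> J" using ne by blast
      define y where "y = x + g i"
      have y: "y \<in> D" "norm y \<le> \<rho>"
        using i norm_triangle_ineq[of x "g i"] g[of i] x by (auto simp: J_def y_def \<rho>_def)
      have J: "J \<subseteq> {..<n}" by (auto simp: J_def)
      have hj: "s * (norm (f j) / 2) - s * \<bar>f j (u i)\<bar> \<le> h j y" if "j \<in> J" for j
      proof -
        have "h j (x + g j) \<ge> 0" using that h0 by (auto simp: J_def)
        moreover have "h j (x + g j) = h j y - s * f j (u j) + s * f j (u i)"
          by (simp add: h_def y_def g_def blinfun.add_right blinfun.scaleR_right)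
        moreover have "s * f j (u j) \<ge> s * (norm (f j) / 2)" "s * f j (u i) \<le> s * \<bar>f j (u i)\<bar>"
          using u(2)[of j] s by (auto intro!: mult_left_mono)
        ultimately show ?thesis by simp
      qed
      have "(\<Sum>j\<in>J. s * (norm (f j) / 2) - s * \<bar>f j (u i)\<bar>) \<le> (\<Sum>j\<in>J. h j y)"
        by (intro sum_mono hj)
      also have "\<dots> \<le> (\<Sum>j<n. h j y)" using J h0 y(1) by (intro sum_mono2) auto
      also have "\<dots> \<le> 2 * e * S" by (rule hsum[OF y(2)])
      \<comment> \<open>Two errors of at most \<open>s / 8 * S\<close>, one from the slack bound and
        one from \<open>p (u i)\<close>, leave the functionals of \<open>J\<close> at most half of
        \<open>S\<close>.\<close>
      finally have 1: "s / 2 * (\<Sum>j\<in>J. norm (f j)) \<le> s / 8 * S + s * (\<Sum>j\<in>J. \<bar>f j (u i)\<bar>)"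
        by (simp add: sum_subtractf e_def sum_distrib_left[symmetric] sum_divide_distrib[symmetric] mult.commute)
      have "(\<Sum>j\<in>J. \<bar>f j (u i)\<bar>) \<le> p (u i)" unfolding p_def using J by (intro sum_mono2) auto
      also have "\<dots> \<le> S / 8" using False by (auto simp: not_less)
      finally have "s * (\<Sum>j\<in>J. \<bar>f j (u i)\<bar>) \<le> s * (S / 8)" using s by (intro mult_left_mono) auto
      then have "s * (\<Sum>j\<in>J. norm (f j)) \<le> s * (S / 2)" using 1 by (simp add: mult.commute)
      then have "(\<Sum>j\<in>J. norm (f j)) \<le> S / 2" using s by simp
      then show ?thesis using Spos
        by (simp add: w_def J_def[symmetric] divide_le_eq flip: sum_divide_distrib)
    qed
    moreover have "\<forall>i. w i \<ge> 0" using S0 by (simp add: w_def)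
    ultimately show ?thesis using g
      by (intro exI[of _ n] exI[of _ g] exI[of _ w]) (auto simp: D_def e_def)
  qed
qed

section \<open>Sums of independent variables\<close>

lemma sets_PiM_measure_pmf:
  fixes q :: "'i \<Rightarrow> ('b :: countable) pmf"
  assumes "finite J"
  shows "sets (PiM J (\<lambda>k. measure_pmf (q k))) = Pow (PiE J (\<lambda>_. UNIV))"
proof -
  have "sets (PiM J (\<lambda>k. measure_pmf (q k))) = sets (PiM J (\<lambda>_. count_space (UNIV :: 'b set)))"
    by (intro sets_PiM_cong) auto
  then show ?thesis using assms by (subst (asm) count_space_PiM_finite) auto
qed

text \<open>Whatever the earlier coordinates are, the next one puts the sum into its target with
  probability at most \<open>1 / 2\<close>. Integrating out the last coordinate therefore halves the
  bound for each index from \<open>m\<close> on.\<close>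

lemma finite_product_stay_prob:
  fixes q :: "nat \<Rightarrow> nat pmf" and g :: "nat \<Rightarrow> nat \<Rightarrow> 'a::real_normed_vector" and D :: "nat \<Rightarrow> 'a set"
  assumes half: "\<And>k y. k \<ge> m \<Longrightarrow>
      measure_pmf.prob (q k) {i. (\<Sum>j<k. g j (y j)) + g k i \<in> D k} \<le> 1 / 2"
  shows "emeasure (PiM {..<N} (\<lambda>k. measure_pmf (q k)))
      {y \<in> PiE {..<N} (\<lambda>_. UNIV). \<forall>k\<in>{m..<N}. (\<Sum>j<Suc k. g j (y j)) \<in> D k} \<le> ennreal ((1 / 2) ^ (N - m))"
proof (induction N)
  case 0
  interpret product_prob_space "\<lambda>k. measure_pmf (q k)" "{..<0::nat}" by unfold_locales
  show ?case using prob_space.emeasure_le_1 by (simp add: P.emeasure_le_1)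
next
  case (Suc N)
  interpret product_prob_space "\<lambda>k. measure_pmf (q k)" "{..<K}" for K :: nat by unfold_locales
  define A where "A N = {y \<in> PiE {..<N} (\<lambda>_. UNIV). \<forall>k\<in>{m..<N}. (\<Sum>j<Suc k. g j (y j)) \<in> D k}" for N
  define M where "M N = PiM {..<N} (\<lambda>k. measure_pmf (q k))" for N :: nat
  have setsM: "sets (M N) = Pow (PiE {..<N} (\<lambda>_. UNIV))" for N
    by (simp add: M_def sets_PiM_measure_pmf)
  have AM: "A N \<in> sets (M N)" for N by (auto simp: setsM A_def)
  show ?case
  proof (cases "m \<le> N")
    \<comment> \<open>Truncated subtraction makes the exponent \<open>0\<close>, so the claim is the
      trivial bound \<open>1\<close>.\<close>
    case False
    then have "Suc N - m = 0" by simp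
    then show ?thesis using P.emeasure_le_1 by simp
  next
    case mN: True
    have "emeasure (M (Suc N)) (A (Suc N)) = (\<integral>\<^sup>+y. indicator (A (Suc N)) y \<partial>M (Suc N))"
      using AM by simp
    also have "\<dots> = (\<integral>\<^sup>+y. (\<integral>\<^sup>+i. indicator (A (Suc N)) (y(N := i)) \<partial>measure_pmf (q N)) \<partial>M N)"
      unfolding M_def lessThan_Suc
      by (rule product_nn_integral_insert) (use AM[of "Suc N"] in \<open>auto simp: M_def lessThan_Suc\<close>)
    also have "\<dots> \<le> (\<integral>\<^sup>+y. ennreal (1 / 2) * indicator (A N) y \<partial>M N)"
    proof (rule nn_integral_mono)
      fix y assume "y \<in> space (M N)"
      then have y: "y \<in> PiE {..<N} (\<lambda>_. UNIV)" by (simp add: M_def space_PiM)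
      define I where "I = {i. (\<Sum>j<N. g j (y j)) + g N i \<in> D N}"
      have sum_upd: "(\<Sum>j<k. g j ((y(N := i)) j)) = (\<Sum>j<k. g j (y j))" if "k \<le> N" for k i
        using that by (intro sum.cong) auto
      have mem: "y \<in> A N" "i \<in> I" if *: "y(N := i) \<in> A (Suc N)" for i
      proof -
        have all: "\<forall>k\<in>{m..<Suc N}. (\<Sum>j<Suc k. g j ((y(N := i)) j)) \<in> D k" using * by (simp add: A_def)
        have "(\<Sum>j<Suc k. g j (y j)) \<in> D k" if "k \<in> {m..<N}" for k
        proof -
          have "(\<Sum>j<Suc k. g j ((y(N := i)) j)) \<in> D k" using that by (intro all[rule_format]) auto
          also have "(\<Sum>j<Suc k. g j ((y(N := i)) j)) = (\<Sum>j<Suc k. g j (y j))"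
            using that by (intro sum_upd) auto
          finally show ?thesis .
        qed
        then show "y \<in> A N" using y unfolding A_def by blast
        have "(\<Sum>j<Suc N. g j ((y(N := i)) j)) \<in> D N" using mN by (intro all[rule_format]) auto
        also have "(\<Sum>j<Suc N. g j ((y(N := i)) j)) = (\<Sum>j<N. g j (y j)) + g N i"
          using sum_upd[of N i] by simp
        finally show "i \<in> I" by (simp add: I_def)
      qed
      have "(\<integral>\<^sup>+i. indicator (A (Suc N)) (y(N := i)) \<partial>measure_pmf (q N))
          \<le> (\<integral>\<^sup>+i. indicator (A N) y * indicator I i \<partial>measure_pmf (q N))"
        using mem by (intro nn_integral_mono) (auto simp: indicator_def)
      also have "\<dots> = indicator (A N) y * emeasure (measure_pmf (q N)) I"
        by (subst nn_integral_cmult) auto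
      also have "\<dots> \<le> indicator (A N) y * ennreal (1 / 2)"
      proof (rule mult_left_mono)
        show "emeasure (measure_pmf (q N)) I \<le> ennreal (1 / 2)"
          unfolding measure_pmf.emeasure_eq_measure I_def by (rule ennreal_leI[OF half[OF mN]])
      qed simp
      finally show "(\<integral>\<^sup>+i. indicator (A (Suc N)) (y(N := i)) \<partial>measure_pmf (q N))
          \<le> ennreal (1 / 2) * indicator (A N) y" by (simp add: mult.commute)
    qed
    also have "\<dots> = ennreal (1 / 2) * emeasure (M N) (A N)"
      using AM by (subst nn_integral_cmult) auto
    also have "\<dots> \<le> ennreal (1 / 2) * ennreal ((1 / 2) ^ (N - m))"
      using Suc.IH by (intro mult_left_mono) (auto simp: M_def A_def)
    also have "\<dots> = ennreal ((1 / 2) ^ (Suc N - m))"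
    proof -
      have "ennreal (1 / 2) * ennreal ((1 / 2) ^ (N - m)) = ennreal (1 / 2 * (1 / 2) ^ (N - m))"
        by (rule ennreal_mult[symmetric]) auto
      then show ?thesis using mN by (simp only: Suc_diff_le power_Suc)
    qed
    finally show ?thesis by (simp add: M_def A_def)
  qed
qed


text \<open>If the random series lands in the translate of \<open>C\<close> by \<open>x\<close>,
  each partial sum is near that translate at the current scale. From some index on these events have
  probability at most \<open>1 / 2\<close> given the past, so the translate has mass at most every
  power of \<open>1 / 2\<close>.\<close>

lemma not_ball_condition_imp_haar_null:
  fixes C :: "'a::banach set"
  assumes C: "C \<noteq> {}" "closed C" and nbc: "\<And>\<rho> r. \<rho> \<ge> 0 \<Longrightarrow> r > 0 \<Longrightarrow> \<not> ball_condition C \<rho> r"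
  shows "haar_null C"
proof -
  \<comment> \<open>The tail after step \<open>k\<close> is at most
    \<open>s (Suc k) * (32 / 31) = s k / 31\<close>, below the width \<open>s k / 16\<close> of the
    neighbourhood.\<close>
  define s :: "nat \<Rightarrow> real" where "s k = (1 / 32) ^ k" for k
  have s0: "s k > 0" for k by (simp add: s_def)
  have "\<exists>g. \<exists>q. (\<forall>i. norm (g i) \<le> s k) \<and> (\<forall>x. norm x \<le> real k \<longrightarrow>
      measure_pmf.prob q {i::nat. \<exists>c\<in>C. norm (x + g i - c) \<le> s k / 16} \<le> 1 / 2)" for k
  proof -
    \<comment> \<open>The admissible radius \<open>k\<close> grows with the step, so every
      translation is eventually covered.\<close>
    have "\<not> ball_condition C (real k + s k) (s k / 16)" using s0[of k] by (intro nbc) auto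
    from not_ball_condition_imp_weights[OF C(1) s0 _ this]
    obtain n :: nat and g :: "nat \<Rightarrow> 'a" and w :: "nat \<Rightarrow> real"
      where gw: "\<forall>i. norm (g i) \<le> s k" "\<forall>i. w i \<ge> 0" "(\<Sum>i<n. w i) = 1"
        and half: "\<forall>x. norm x \<le> real k \<longrightarrow> (\<Sum>i\<in>{..<n} \<inter> {i. \<exists>c\<in>C. norm (x + g i - c) \<le> s k / 16}. w i) \<le> 1 / 2"
      by auto
    obtain q where "\<And>A. measure_pmf.prob q A = (\<Sum>i\<in>{..<n} \<inter> A. w i)"
      using pmf_of_weights[of w n] gw(2,3) by blast
    then show ?thesis using gw(1) half by (intro exI[of _ g] exI[of _ q]) simp
  qed
  then have "\<forall>k. \<exists>g. \<exists>q. (\<forall>i. norm (g i) \<le> s k) \<and> (\<forall>x. norm x \<le> real k \<longrightarrow>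
      measure_pmf.prob q {i::nat. \<exists>c\<in>C. norm (x + g i - c) \<le> s k / 16} \<le> 1 / 2)" by (rule allI)
  from choice[OF this] obtain g where "\<forall>k. \<exists>q. (\<forall>i. norm (g k i) \<le> s k) \<and> (\<forall>x. norm x \<le> real k \<longrightarrow>
      measure_pmf.prob q {i::nat. \<exists>c\<in>C. norm (x + g k i - c) \<le> s k / 16} \<le> 1 / 2)" by (elim exE)
  from choice[OF this] obtain q where gq: "\<forall>k. (\<forall>i. norm (g k i) \<le> s k) \<and> (\<forall>x. norm x \<le> real k \<longrightarrow>
      measure_pmf.prob (q k) {i::nat. \<exists>c\<in>C. norm (x + g k i - c) \<le> s k / 16} \<le> 1 / 2)" by (elim exE)
  have g: "\<And>k i. norm (g k i :: 'a) \<le> s k"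
    and half: "\<And>k x. norm x \<le> real k \<Longrightarrow>
      measure_pmf.prob (q k) {i::nat. \<exists>c\<in>C. norm (x + g k i - c) \<le> s k / 16} \<le> 1 / 2"
    using gq by simp_all
  have s_sums: "(\<lambda>j. s (j + k)) sums (s k * (32 / 31))" for k
    using sums_mult[OF geometric_sums[of "1 / 32 :: real"], of "s k"]
    by (simp add: s_def power_add mult.commute)
  have summ: "summable (\<lambda>j. g (j + k) (\<omega> (j + k)))" for \<omega> k
    by (rule summable_comparison_test'[OF sums_summable[OF s_sums[of k]]]) (rule g)
  have norm_tail: "norm (suminf (\<lambda>j. g (j + k) (\<omega> (j + k)))) \<le> s k * (32 / 31)" for \<omega> k
  proof -
    have abs: "summable (\<lambda>j. norm (g (j + k) (\<omega> (j + k))))"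
      by (rule summable_comparison_test'[OF sums_summable[OF s_sums[of k]]]) (simp add: g)
    have "norm (suminf (\<lambda>j. g (j + k) (\<omega> (j + k)))) \<le> suminf (\<lambda>j. norm (g (j + k) (\<omega> (j + k))))"
      by (rule summable_norm[OF abs])
    also have "\<dots> \<le> suminf (\<lambda>j. s (j + k))"
      by (rule suminf_le[OF g abs sums_summable[OF s_sums]])
    also have "\<dots> = s k * (32 / 31)" by (rule sums_unique[OF s_sums, symmetric])
    finally show ?thesis .
  qed
  define S where "S \<omega> = suminf (\<lambda>j. g j (\<omega> j))" for \<omega>
  have tail: "norm (S \<omega> - (\<Sum>j<Suc k. g j (\<omega> j))) \<le> s k / 16" for \<omega> k
  proof -
    have "norm (S \<omega> - (\<Sum>j<Suc k. g j (\<omega> j))) \<le> s (Suc k) * (32 / 31)"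
      using norm_tail[of "Suc k" \<omega>] suminf_minus_initial_segment[of "\<lambda>j. g j (\<omega> j)" "Suc k"] summ[of 0 \<omega>]
      by (simp add: S_def)
    also have "\<dots> \<le> s k / 16" using s0[of k] by (simp add: s_def)
    finally show ?thesis .
  qed
  have partial: "norm (\<Sum>j<k. g j (\<omega> j)) \<le> 2" for \<omega> k
  proof -
    have "norm (\<Sum>j<k. g j (\<omega> j)) \<le> (\<Sum>j<k. s j)" using g by (rule sum_norm_le)
    also have "\<dots> \<le> suminf s"
      using s_sums[of 0] s0 by (intro sum_le_suminf) (auto simp: sums_iff intro: less_imp_le)
    also have "\<dots> \<le> 2" using sums_unique[OF s_sums[of 0]] by (simp add: s_def[of 0])
    finally show ?thesis .
  qed
  \<comment> \<open>Uniform convergence makes \<open>S\<close> continuous on the sequence space. As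
    the naturals are countable and discrete, its Borel sets are the product events, and
    \<open>S\<close> is measurable.\<close>
  have "uniform_limit UNIV (\<lambda>n \<omega>. \<Sum>j<n. g j (\<omega> j)) S sequentially"
    unfolding S_def using g sums_summable[OF s_sums[of 0]]
    by (intro Weierstrass_m_test[of _ _ s]) auto
  moreover have "continuous_on UNIV (\<lambda>\<omega>. \<Sum>j<n. g j (\<omega> j))" for n
    by (intro continuous_on_sum continuous_on_compose2[OF Topological_Spaces.continuous_on_discrete[of UNIV "g _"]]
        continuous_on_product_coordinates) auto
  ultimately have contS: "continuous_on UNIV S"
    by (intro uniform_limit_theorem[where F = sequentially]) auto
  define M where "M = PiM UNIV (\<lambda>k. measure_pmf (q k))"
  interpret product_prob_space "\<lambda>k. measure_pmf (q k)" UNIV by unfold_locales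
  have "sets M = sets (PiM UNIV (\<lambda>_::nat. borel :: nat measure))"
    unfolding M_def by (intro sets_PiM_cong) (auto simp: sets_borel_eq_count_space)
  then have setsM: "sets M = sets borel" by (simp add: sets_PiM_equal_borel)
  then have spaceM: "space M = UNIV" using sets_eq_imp_space_eq by fastforce
  have measS: "S \<in> borel_measurable M"
    using borel_measurable_continuous_onI[OF contS] measurable_cong_sets[OF setsM refl] by blast
  have "emeasure (distr M borel S) ((+) x ` C) = 0" for x
  proof -
    have "emeasure (distr M borel S) ((+) x ` C) = emeasure M {\<omega>. S \<omega> \<in> (+) x ` C}"
      using measS closed_translation[OF C(2), of x] spaceM by (subst emeasure_distr) (auto simp: vimage_def)
    moreover have "emeasure M {\<omega>. S \<omega> \<in> (+) x ` C} \<le> ennreal ((1 / 2) ^ n)" for n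
    proof -
      \<comment> \<open>Partial sums have norm at most \<open>2\<close>, so from index
        \<open>m\<close> on, shifting by \<open>x\<close> keeps them within radius \<open>k\<close>.
        The first \<open>m + n\<close> steps then contain \<open>n\<close> halvings.\<close>
      obtain m :: nat where m: "norm x + 2 \<le> real m" using real_arch_simple by blast
      define D where "D k = {y. \<exists>c\<in>C. norm (y - x - c) \<le> s k / 16}" for k
      define A where "A = {y \<in> PiE {..<m + n} (\<lambda>_. UNIV). \<forall>k\<in>{m..<m + n}. (\<Sum>j<Suc k. g j (y j)) \<in> D k}"
      have "emeasure (PiM {..<m + n} (\<lambda>k. measure_pmf (q k))) A \<le> ennreal ((1 / 2) ^ (m + n - m))"
        unfolding A_def
      proof (rule finite_product_stay_prob)
        fix k :: nat and y assume k: "k \<ge> m"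
        have "norm ((\<Sum>j<k. g j (y j)) - x) \<le> real k"
          using norm_triangle_ineq4[of "\<Sum>j<k. g j (y j)" x] partial[of y k] m k by simp
        from half[OF this]
        show "measure_pmf.prob (q k) {i. (\<Sum>j<k. g j (y j)) + g k i \<in> D k} \<le> 1 / 2"
          by (simp add: D_def algebra_simps)
      qed
      moreover have "A \<in> sets (PiM {..<m + n} (\<lambda>k. measure_pmf (q k)))"
        by (auto simp: sets_PiM_measure_pmf A_def)
      moreover have "{\<omega>. S \<omega> \<in> (+) x ` C} \<subseteq> prod_emb UNIV (\<lambda>k. measure_pmf (q k)) {..<m + n} A"
      proof
        fix \<omega> assume "\<omega> \<in> {\<omega>. S \<omega> \<in> (+) x ` C}"
        then obtain c where c: "c \<in> C" "S \<omega> = x + c" by auto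
        have "(\<Sum>j<Suc k. g j (\<omega> j)) \<in> D k" for k
          unfolding D_def using c tail[of \<omega> k]
          by (intro CollectI bexI[of _ c]) (auto simp: norm_minus_commute algebra_simps)
        moreover have "(\<Sum>j<Suc k. g j (restrict \<omega> {..<m + n} j)) = (\<Sum>j<Suc k. g j (\<omega> j))"
          if "k < m + n" for k
          using that by (intro sum.cong) auto
        ultimately have "restrict \<omega> {..<m + n} \<in> A"
          unfolding A_def by (intro CollectI conjI ballI) (simp_all del: sum.lessThan_Suc)
        then show "\<omega> \<in> prod_emb UNIV (\<lambda>k. measure_pmf (q k)) {..<m + n} A" by (simp add: prod_emb_def)
      qed
      ultimately have "emeasure M {\<omega>. S \<omega> \<in> (+) x ` C} \<le> ennreal ((1 / 2) ^ (m + n - m))"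
        unfolding M_def
        using emeasure_PiM_emb'[of "{..<m + n}" A]
          emeasure_mono[of "{\<omega>. S \<omega> \<in> (+) x ` C}" "prod_emb UNIV (\<lambda>k. measure_pmf (q k)) {..<m + n} A"
            "PiM UNIV (\<lambda>k. measure_pmf (q k))"]
        by (auto intro: order_trans)
      then show ?thesis by simp
    qed
    moreover have "(\<lambda>n. ennreal ((1 / 2) ^ n)) \<longlonglongrightarrow> ennreal 0"
      by (intro tendsto_ennrealI LIMSEQ_power_zero) simp
    ultimately have "emeasure (distr M borel S) ((+) x ` C) \<le> ennreal 0"
      by (intro LIMSEQ_le_const) auto
    then show ?thesis by simp
  qed
  moreover have "prob_space (distr M borel S)"
    using P.prob_space_distr[of S borel] measS by (simp add: M_def)
  moreover have "sets (distr M borel S) = sets borel" by simp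
  moreover have "C \<in> sets borel" using C(2) by simp
  ultimately show ?thesis unfolding haar_null_def by blast
qed

theorem theorem3p1:
  fixes C :: "'a::banach set" and \<rho> r :: real
  assumes "\<rho> > 0" and "C \<noteq> {}" and "closed C" and "convex C" and "r \<ge> 0"
  shows
    "((loose_radius C \<rho> \<ge> ereal r) \<longleftrightarrow>
        (\<forall>F. finite F \<and> F \<subseteq> cball 0 r \<longrightarrow>
           (\<exists>z \<in> cball (0 :: 'a bidual) \<rho>. (+) z ` canonical_embed ` F \<subseteq> wstar_cl C)))
   \<and> ((\<forall>F. finite F \<and> F \<subseteq> cball 0 r \<longrightarrow>
           (\<exists>z \<in> cball (0 :: 'a bidual) \<rho>. (+) z ` canonical_embed ` F \<subseteq> wstar_cl C)) \<longleftrightarrow>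
        (\<exists>z\<^sub>0 \<in> cball (0 :: 'a bidual) \<rho>. (+) z\<^sub>0 ` cball 0 r \<subseteq> wstar_cl C))
   \<and> loose_radius C \<rho> = inner_radius (wstar_cl C) \<rho>
   \<and> (separable_space (euclidean :: 'a topology) \<longrightarrow>
        (haar_positive C \<longleftrightarrow> interior (wstar_cl C) \<noteq> {}))"
proof -
  have \<rho>: "\<rho> \<ge> 0" using assms(1) by simp
  note equiv = ball_condition_iff_finite_translates[OF assms(4,2) \<rho> assms(5)]
  have "haar_positive C \<longleftrightarrow> interior (wstar_cl C) \<noteq> {}"
    if sep: "separable_space (euclidean :: 'a topology)"
  proof -
    have "\<not> haar_null C \<longleftrightarrow> (\<exists>\<rho>\<ge>0. \<exists>r>0. ball_condition C \<rho> r)"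
      using not_ball_condition_imp_haar_null[OF assms(2,3)]
        ball_condition_imp_not_haar_null[OF assms(4,2,3) _ _ _ sep] by blast
    then show ?thesis
      using interior_wstar_cl_nonempty_iff[OF assms(4,2)] assms(3) by (simp add: haar_positive_def)
  qed
  then show ?thesis
    using loose_radius_ge_iff[OF assms(4,2) \<rho> assms(5)] equiv
      loose_radius_eq_inner_radius[OF assms(4,2) \<rho>] by simp
qed


end
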